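(* Let $\gamma$ be a real number, $\sigma$ a finite positive measure on the real line, $p$ a positive integer, and let $\nu_{\boxplus}^{\gamma,\sigma}$ be the $\boxplus$-infinitely divisible distribution associated with $(\gamma,\sigma)$. 1) If $\sigma$ admits a moment of order $p$, then $\nu_{\boxplus}^{\gamma,\sigma}$ admits a moment of order $p$. 2) Suppose moreover that $p$ is even or that the support of $\sigma$ is bounded below or bounded above. In this case, if $\nu_{\boxplus}^{\gamma,\sigma}$ admits a moment of order $p$, then $\sigma$ admits a moment of order $p$.
   Context: A finite positive measure $\rho$ on $\mathbb{R}$ admits a moment of order $p$ if $\int_{\mathbb{R}}|t|^p\,d\rho(t)<\infty$. For $\alpha,\beta>0$ let $\Delta_{\alpha,\beta}=\{z=x+iy\in\mathbb{C}: |x|<-\alpha y,\ |z|<\beta\}$. The $R$-transform: for a probability measure $\mu$ on $\mathbb{R}$, its Cauchy transform is $G_\mu(z)=\int_{\mathbb{R}}\frac{d\mu(t)}{z-t}$ for $z$ in the upper half-plane. It is known that for all $\alpha>0$, all $\varepsilon\in(0,\min\{\alpha,1\})$ and all small enough $\beta>0$, the map $z\mapsto G_\mu(1/z)$ is a conformal bijection from $\Delta_{\alpha,\beta}$ onto an open set $\mathcal{D}_{\alpha,\beta}$ with $\Delta_{\alpha-\varepsilon,(1-\varepsilon)\beta}\subset\mathcal{D}_{\alpha,\beta}\subset\Delta_{\alpha+\varepsilon,(1+\varepsilon)\beta}$. The inverses of these bijections define together an analytic function $L_\mu$ on the union of the sets $\mathcal{D}_{\alpha,\beta}$; one sets $K_\mu=1/L_\mu$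 and $R_\mu(z)=K_\mu(z)-1/z$. The $R$-transform determines $\mu$, and the free convolution $\boxplus$ of probability measures on $\mathbb{R}$ satisfies $R_{\mu\boxplus\nu}=R_\mu+R_\nu$ (on the sets $\Delta_{\alpha,\beta}$ where all are defined). A probability measure $\mu$ is $\boxplus$-infinitely divisible if for every integer $n\ge1$ there is a probability measure $\nu_n$ whose $n$-fold free convolution $\nu_n^{\boxplus n}$ equals $\mu$. It is known that $\mu$ is $\boxplus$-infinitely divisible if and only if there are $\gamma\in\mathbb{R}$ and a finite positive measure $\sigma$ on $\mathbb{R}$ with $R_\mu(z)=\gamma+\int_{\mathbb{R}}\frac{z+t}{1-tz}\,d\sigma(t)$; the pair $(\gamma,\sigma)$ is then unique, every such pair occurs, and $\mu$ is denoted $\nu_{\boxplus}^{\gamma,\sigma}$. The measure $\sigma$ is called here the Lévy measure of $\nu_{\boxplus}^{\gamma,\sigma}$. *)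

theory Defs
  imports "HOL-Probability.Probability" "HOL-Complex_Analysis.Complex_Analysis"
begin

definition admits_moment :: "real measure \<Rightarrow> nat \<Rightarrow> bool" where
  "admits_moment \<rho> p \<longleftrightarrow> integrable \<rho> (\<lambda>t. \<bar>t\<bar> ^ p)"

definition measure_support :: "'a::topological_space measure \<Rightarrow> 'a set" where
  "measure_support M = {x. \<forall>U. open U \<longrightarrow> x \<in> U \<longrightarrow> emeasure M U > 0}"

definition Delta :: "real \<Rightarrow> real \<Rightarrow> complex set" where
  "Delta \<alpha> \<beta> = {z. \<bar>Re z\<bar> < - \<alpha> * Im z \<and> cmod z < \<beta>}"

definition cauchy_transform :: "real measure \<Rightarrow> complex \<Rightarrow> complex" where
  "cauchy_transform \<mu> z = (LINT t|\<mu>. 1 / (z - complex_of_real t))"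

definition cauchy_inv :: "real measure \<Rightarrow> complex \<Rightarrow> complex" where
  "cauchy_inv \<mu> z = cauchy_transform \<mu> (1 / z)"

definition L_branch :: "real measure \<Rightarrow> real \<Rightarrow> real \<Rightarrow> complex \<Rightarrow> complex" where
  "L_branch \<mu> \<alpha> \<beta> = the_inv_into (Delta \<alpha> \<beta>) (cauchy_inv \<mu>)"

text \<open>
  The R-transform of a probability measure is only determined near \<open>0\<close> inside cones: its
  domain is a union of sets \<open>cauchy_inv \<mu> ` Delta \<alpha> \<beta>\<close> over all \<open>\<alpha> > 0\<close> and all
  \<open>\<beta>\<close> small enough depending on \<open>\<alpha>\<close>, where how small is immaterial. Hence a relation:
  \<open>R\<close> represents the R-transform of \<open>\<mu>\<close> if, on each of these sets, it is \<open>1 / L - 1 / w\<close>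
  for the inverse branch \<open>L\<close>. The injectivity clause holds for every probability measure; it
  only ensures that \<open>L_branch\<close> is a genuine inverse.
\<close>

definition has_R_transform :: "real measure \<Rightarrow> (complex \<Rightarrow> complex) \<Rightarrow> bool" where
  "has_R_transform \<mu> R \<longleftrightarrow>
     (\<forall>\<alpha>>0. \<forall>\<^sub>F \<beta> in at_right 0.
        inj_on (cauchy_inv \<mu>) (Delta \<alpha> \<beta>) \<and>
        (\<forall>w \<in> cauchy_inv \<mu> ` Delta \<alpha> \<beta>. R w = 1 / L_branch \<mu> \<alpha> \<beta> w - 1 / w))"

text \<open>
  \<open>\<mu>\<close> is the freely infinitely divisible law with parameters \<open>(\<gamma>, \<sigma>)\<close>. Since the R-transform
  determines the measure, there is at most one such \<open>\<mu>\<close>; by the free Levy-Khintchine theorem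
  there is exactly one, and it is freely infinitely divisible.
\<close>

definition is_free_id_law :: "real \<Rightarrow> real measure \<Rightarrow> real measure \<Rightarrow> bool" where
  "is_free_id_law \<gamma> \<sigma> \<mu> \<longleftrightarrow>
     real_distribution \<mu> \<and>
     has_R_transform \<mu>
       (\<lambda>z. complex_of_real \<gamma> +
          (LINT t|\<sigma>. (z + complex_of_real t) / (1 - complex_of_real t * z)))"

end

theory Submission
  imports Defs
begin

text \<open>
  For a finite measure \<open>\<rho>\<close> let \<open>M\<^sub>\<rho>(z) = \<integral> 1/(1 - t z) d\<rho>(t)\<close>. With \<open>w = G\<^sub>\<nu>(1/z) = z M\<^sub>\<nu>(z)\<close>, the
  relation \<open>1/z = 1/w + R(w)\<close> becomes
  \<open>M\<^sub>\<nu>(z) = 1 - \<sigma>(\<real>) + \<gamma> w + (1 + w\<^sup>2) M\<^sub>\<sigma>(w)\<close>, so it suffices to let \<open>z = - \<i> \<eta>\<close>, \<open>\<eta> \<rightarrow> 0+\<close>: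
  an expansion of \<open>M\<^sub>\<sigma>\<close> in powers of \<open>w\<close> with real coefficients is equivalent to one of \<open>M\<^sub>\<nu>\<close> in
  powers of \<open>z\<close>. Expansions with bounded remainder characterise even moments (Hamburger), and
  odd moments of measures on a half-line. Odd absolute moments of a general measure correspond to
  the finer requirement that the imaginary part of the remainder be integrable against \<open>d\<eta>/\<eta>\<close>;
  such remainders still form an algebra, so they pass from \<open>\<sigma>\<close> to \<open>\<nu>\<close>.
\<close>

subsection \<open>Germs at 0 and asymptotic expansions\<close>

definition bounded_germ :: "(real \<Rightarrow> complex) \<Rightarrow> bool" where
  "bounded_germ f \<longleftrightarrow> (\<exists>C. \<forall>\<^sub>F \<eta> in at_right 0. cmod (f \<eta>) \<le> C)"

text \<open>The remainder class that detects odd absolute moments: for odd \<open>p\<close>, the integral of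
  \<open>\<bar>t\<bar>\<^sup>p\<close> is comparable to that of \<open>\<bar>Im (\<integral> t\<^sup>p / (1 - t w(\<eta>)))\<bar> / \<eta>\<close> over small \<open>\<eta>\<close>.
  The majorant \<open>h\<close> spares measurability of \<open>f\<close>.\<close>

definition Im_integrable_germ :: "(real \<Rightarrow> complex) \<Rightarrow> bool" where
  "Im_integrable_germ f \<longleftrightarrow> bounded_germ f \<and>
     (\<exists>h. \<exists>\<epsilon>>0. set_integrable lborel {0<..<\<epsilon>} h \<and> (\<forall>\<^sub>F \<eta> in at_right 0. \<bar>Im (f \<eta>)\<bar> \<le> \<eta> * h \<eta>))"

text \<open>\<open>f = a\<^sub>0 + a\<^sub>1 w + \<dots> + a\<^bsub>n-1\<^esub> w\<^bsup>n-1\<^esup> + w\<^sup>n g\<close> with real \<open>a\<^sub>i\<close> and \<open>g\<close> in \<open>B\<close>.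
  Reality of the coefficients is what makes imaginary parts of remainders informative.\<close>

primrec expansion ::
  "((real \<Rightarrow> complex) \<Rightarrow> bool) \<Rightarrow> (real \<Rightarrow> complex) \<Rightarrow> nat \<Rightarrow> (real \<Rightarrow> complex) \<Rightarrow> bool" where
  "expansion B w 0 f \<longleftrightarrow> B f"
| "expansion B w (Suc n) f \<longleftrightarrow>
     (\<exists>(a::real) g. expansion B w n g \<and> (\<forall>\<^sub>F \<eta> in at_right 0. f \<eta> = of_real a + w \<eta> * g \<eta>))"

lemma expansion_SucI:
  assumes "expansion B w n g" "\<forall>\<^sub>F \<eta> in at_right 0. f \<eta> = of_real a + w \<eta> * g \<eta>"
  shows "expansion B w (Suc n) f"
  using assms by auto

lemma expansion_SucE:
  assumes "expansion B w (Suc n) f"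
  obtains a g where "expansion B w n g" "\<forall>\<^sub>F \<eta> in at_right 0. f \<eta> = of_real a + w \<eta> * g \<eta>"
  using assms by auto

section \<open>Arithmetic of expansions over a remainder class\<close>

definition small_germ :: "(real \<Rightarrow> complex) \<Rightarrow> bool" where
  "small_germ w \<longleftrightarrow> (\<exists>C. \<forall>\<^sub>F \<eta> in at_right 0. cmod (w \<eta>) \<le> C * \<eta>)"

text \<open>Collects what sums, products and changes of variable of expansions ask of the remainder
  class, so that bounded remainders and remainders with integrable imaginary part share one theory.
  \<open>small\<close> puts the variable itself in the class, which lets the last term of an
  expansion be absorbed in a shorter remainder.\<close>

locale germ_algebra =
  fixes B :: "(real \<Rightarrow> complex) \<Rightarrow> bool"
  assumes const: "B (\<lambda>_. of_real a)"
    and add: "B f \<Longrightarrow> B g \<Longrightarrow> B (\<lambda>\<eta>. f \<eta> + g \<eta>)"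
    and mult: "B f \<Longrightarrow> B g \<Longrightarrow> B (\<lambda>\<eta>. f \<eta> * g \<eta>)"
    and cong: "B f \<Longrightarrow> \<forall>\<^sub>F \<eta> in at_right 0. g \<eta> = f \<eta> \<Longrightarrow> B g"
    and small: "small_germ w \<Longrightarrow> B w"
    and bounded: "B f \<Longrightarrow> bounded_germ f"
begin

lemma expansion_cong:
  assumes "expansion B w n f" "\<forall>\<^sub>F \<eta> in at_right 0. g \<eta> = f \<eta>"
  shows "expansion B w n g"
proof (cases n)
  case 0
  then show ?thesis using assms cong by auto
next
  case (Suc m)
  then obtain a h where "expansion B w m h" "\<forall>\<^sub>F \<eta> in at_right 0. f \<eta> = complex_of_real a + w \<eta> * h \<eta>"
    using assms by auto
  moreover from this(2) assms(2) have "\<forall>\<^sub>F \<eta> in at_right 0. g \<eta> = complex_of_real a + w \<eta> * h \<eta>"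
    by eventually_elim simp
  ultimately show ?thesis using Suc by auto
qed

lemma expansion_const: "expansion B w n (\<lambda>_. of_real a)"
proof (induction n arbitrary: a)
  case (Suc n)
  show ?case using Suc[of 0] by (auto intro!: exI[of _ a] exI[of _ "\<lambda>_. 0"])
qed (simp add: const)

lemma expansion_add: "expansion B w n f \<Longrightarrow> expansion B w n g \<Longrightarrow> expansion B w n (\<lambda>\<eta>. f \<eta> + g \<eta>)"
proof (induction n arbitrary: f g)
  case (Suc n)
  from Suc.prems obtain a f' b g' where
    *: "expansion B w n f'" "\<forall>\<^sub>F \<eta> in at_right 0. f \<eta> = of_real a + w \<eta> * f' \<eta>"
       "expansion B w n g'" "\<forall>\<^sub>F \<eta> in at_right 0. g \<eta> = of_real b + w \<eta> * g' \<eta>"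
    by auto
  have "\<forall>\<^sub>F \<eta> in at_right 0. f \<eta> + g \<eta> = of_real (a + b) + w \<eta> * (f' \<eta> + g' \<eta>)"
    using *(2,4) by eventually_elim (simp add: algebra_simps)
  then show ?case using Suc.IH[OF *(1,3)] 
    by (auto intro!: exI[of _ "a + b"] exI[of _ "\<lambda>\<eta>. f' \<eta> + g' \<eta>"])
qed (simp add: add)

lemma expansion_base:
  assumes "small_germ w" "expansion B w n f"
  shows "B f"
  using assms(2)
proof (induction n arbitrary: f)
  case (Suc n)
  then obtain a g where *: "expansion B w n g" "\<forall>\<^sub>F \<eta> in at_right 0. f \<eta> = of_real a + w \<eta> * g \<eta>"
    by auto
  have "B (\<lambda>\<eta>. of_real a + w \<eta> * g \<eta>)"
    by (rule add[OF const mult[OF small[OF assms(1)] Suc.IH[OF *(1)]]])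
  then show ?case using *(2) cong by blast
qed simp

lemma expansion_Suc_lower:
  assumes "small_germ w"
  shows "expansion B w (Suc n) f \<Longrightarrow> expansion B w n f"
proof (induction n arbitrary: f)
  case 0
  then show ?case using expansion_base[OF assms] by (metis expansion.simps(1))
next
  case (Suc n)
  from Suc.prems obtain a g where "expansion B w (Suc n) g"
    "\<forall>\<^sub>F \<eta> in at_right 0. f \<eta> = of_real a + w \<eta> * g \<eta>"
    by (rule expansion_SucE)
  with Suc.IH show ?case by (blast intro: expansion_SucI)
qed

lemma expansion_lower:
  assumes "small_germ w" "expansion B w n f" "m \<le> n"
  shows "expansion B w m f"
  using assms(3,2) by (induction n rule: dec_induct) (blast intro: expansion_Suc_lower[OF assms(1)])+

lemma expansion_shift: "expansion B w n f \<Longrightarrow> expansion B w (Suc n) (\<lambda>\<eta>. w \<eta> * f \<eta>)"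
  by (auto intro!: exI[of _ 0] exI[of _ f])

lemma expansion_self: 
  assumes "small_germ w"
  shows "expansion B w n w"
  using expansion_lower[OF assms expansion_shift[OF expansion_const[of w n 1]], of n] by simp

lemma expansion_mult:
  assumes w: "small_germ w"
  shows "expansion B w n f \<Longrightarrow> expansion B w n g \<Longrightarrow> expansion B w n (\<lambda>\<eta>. f \<eta> * g \<eta>)"
proof (induction n arbitrary: f g)
  case (Suc n)
  from Suc.prems obtain a f' b g' where
    *: "expansion B w n f'" "\<forall>\<^sub>F \<eta> in at_right 0. f \<eta> = of_real a + w \<eta> * f' \<eta>"
       "expansion B w n g'" "\<forall>\<^sub>F \<eta> in at_right 0. g \<eta> = of_real b + w \<eta> * g' \<eta>"
    by auto
  \<comment> \<open>Only one factor is split at a time, \<open>f g = b f + w f g'\<close>, so no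
    term quadratic in \<open>w\<close> appears and \<open>f\<close> itself is needed merely to order
    \<open>n\<close>.\<close>
  define h where "h = (\<lambda>\<eta>. (f \<eta> * g' \<eta>) + (of_real b * f' \<eta>))"
  have "\<forall>\<^sub>F \<eta> in at_right 0. f \<eta> * g \<eta> = of_real (a * b) + w \<eta> * h \<eta>"
    using *(2,4) by eventually_elim (simp add: algebra_simps h_def)
  moreover have "expansion B w n h" unfolding h_def
    using Suc.IH * expansion_Suc_lower[OF w Suc.prems(1)]
    by (intro expansion_add Suc.IH expansion_const) auto
  ultimately show ?case by (intro expansion_SucI)
qed (simp add: mult)

text \<open>In \<open>w = z u\<close> the factor \<open>z\<close> already supplies one order, so
  \<open>n\<close> terms of \<open>u\<close> suffice for \<open>n + 1\<close> terms of
  \<open>f\<close>. This gain drives the later bootstraps.\<close>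

lemma expansion_change_of_variable:
  assumes z: "small_germ z" and w: "\<forall>\<^sub>F \<eta> in at_right 0. w \<eta> = z \<eta> * u \<eta>"
  shows "expansion B w (Suc n) f \<Longrightarrow> expansion B z n u \<Longrightarrow> expansion B z (Suc n) f"
proof (induction n arbitrary: f)
  case 0
  then obtain a g where *: "B g" "\<forall>\<^sub>F \<eta> in at_right 0. f \<eta> = of_real a + w \<eta> * g \<eta>" by auto
  have "\<forall>\<^sub>F \<eta> in at_right 0. f \<eta> = of_real a + z \<eta> * (u \<eta> * g \<eta>)"
    using *(2) w by eventually_elim simp
  moreover have "B (\<lambda>\<eta>. u \<eta> * g \<eta>)" using * 0 mult by simp
  ultimately show ?case by auto
next
  case (Suc n)
  from Suc.prems(1) obtain a g where *: "expansion B w (Suc n) g"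
    "\<forall>\<^sub>F \<eta> in at_right 0. f \<eta> = of_real a + w \<eta> * g \<eta>" by (rule expansion_SucE)
  have "expansion B z (Suc n) g" 
    using Suc.IH *(1) expansion_Suc_lower[OF z Suc.prems(2)] by blast
  then have "expansion B z (Suc n) (\<lambda>\<eta>. u \<eta> * g \<eta>)" 
    using Suc.prems(2) expansion_mult[OF z] by blast
  moreover have "\<forall>\<^sub>F \<eta> in at_right 0. f \<eta> = of_real a + z \<eta> * (u \<eta> * g \<eta>)"
    using *(2) w by eventually_elim simp
  ultimately show ?case by (rule expansion_SucI)
qed

end

section \<open>The two remainder classes\<close>

interpretation bounded: germ_algebra bounded_germ
proof
  show "bounded_germ (\<lambda>_. of_real a)" for a
    by (auto simp: bounded_germ_def intro!: exI[of _ "\<bar>a\<bar>"])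
next
  fix f g assume "bounded_germ f" "bounded_germ g"
  then obtain C D where *: "\<forall>\<^sub>F \<eta> in at_right 0. cmod (f \<eta>) \<le> C" "\<forall>\<^sub>F \<eta> in at_right 0. cmod (g \<eta>) \<le> D"
    by (auto simp: bounded_germ_def)
  then have "\<forall>\<^sub>F \<eta> in at_right 0. cmod (f \<eta> + g \<eta>) \<le> C + D"
    by eventually_elim (rule norm_triangle_mono)
  then show "bounded_germ (\<lambda>\<eta>. f \<eta> + g \<eta>)" unfolding bounded_germ_def by blast
  from * have "\<forall>\<^sub>F \<eta> in at_right 0. cmod (f \<eta> * g \<eta>) \<le> C * D"
  proof eventually_elim
    case (elim \<eta>)
    then show ?case using mult_mono[OF elim] order_trans[OF norm_ge_zero elim(1)]
      by (simp add: norm_mult)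
  qed
  then show "bounded_germ (\<lambda>\<eta>. f \<eta> * g \<eta>)" unfolding bounded_germ_def by blast
next
  fix f g :: "real \<Rightarrow> complex" assume "bounded_germ f" and *: "\<forall>\<^sub>F \<eta> in at_right 0. g \<eta> = f \<eta>"
  then obtain C where "\<forall>\<^sub>F \<eta> in at_right 0. cmod (f \<eta>) \<le> C"
    by (auto simp: bounded_germ_def)
  with * have "\<forall>\<^sub>F \<eta> in at_right 0. cmod (g \<eta>) \<le> C"
    by eventually_elim simp
  then show "bounded_germ g" unfolding bounded_germ_def by blast
next
  fix w assume "small_germ w"
  then obtain C where *: "\<forall>\<^sub>F \<eta> in at_right 0. cmod (w \<eta>) \<le> C * \<eta>" by (auto simp: small_germ_def)
  have "\<forall>\<^sub>F \<eta> in at_right (0::real). \<eta> \<in> {0<..<1}" by (rule eventually_at_right_real) simp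
  with * have "\<forall>\<^sub>F \<eta> in at_right 0. cmod (w \<eta>) \<le> \<bar>C\<bar>"
  proof eventually_elim
    case (elim \<eta>)
    have "C * \<eta> \<le> \<bar>C\<bar> * 1" using elim by (intro mult_mono) auto
    with elim show ?case by simp
  qed
  then show "bounded_germ w" unfolding bounded_germ_def by blast
qed

lemma Im_integrable_germI:
  assumes "bounded_germ f" "\<epsilon> > 0" "set_integrable lborel {0<..<\<epsilon>} h"
    "\<forall>\<^sub>F \<eta> in at_right 0. \<bar>Im (f \<eta>)\<bar> \<le> \<eta> * h \<eta>"
  shows "Im_integrable_germ f"
  using assms unfolding Im_integrable_germ_def by blast

text \<open>Products stay in the class because \<open>Im (f g) = Re f Im g + Re g Im f\<close> with
  bounded real parts; a germ of size at most \<open>C \<eta>\<close> has the constant majorant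
  \<open>C\<close>.\<close>

interpretation Im_integrable: germ_algebra Im_integrable_germ
proof
  show "Im_integrable_germ (\<lambda>_. of_real a)" for a
    by (rule Im_integrable_germI[where \<epsilon>=1 and h="\<lambda>_. 0"])
       (auto simp: bounded.const set_integrable_def)
next
  fix f g assume f: "Im_integrable_germ f" and g: "Im_integrable_germ g"
  obtain h \<epsilon> where h: "\<epsilon> > 0" "set_integrable lborel {0<..<\<epsilon>} h" 
     "\<forall>\<^sub>F \<eta> in at_right 0. \<bar>Im (f \<eta>)\<bar> \<le> \<eta> * h \<eta>" "bounded_germ f"
    using f by (auto simp: Im_integrable_germ_def)
  obtain k \<delta> where k: "\<delta> > 0" "set_integrable lborel {0<..<\<delta>} k" 
     "\<forall>\<^sub>F \<eta> in at_right 0. \<bar>Im (g \<eta>)\<bar> \<le> \<eta> * k \<eta>" "bounded_germ g"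
    using g by (auto simp: Im_integrable_germ_def)
  obtain C D where CD: "\<forall>\<^sub>F \<eta> in at_right 0. cmod (f \<eta>) \<le> C" "\<forall>\<^sub>F \<eta> in at_right 0. cmod (g \<eta>) \<le> D"
    using h k by (auto simp: bounded_germ_def)
  define e where "e = min \<epsilon> \<delta>"
  have e: "e > 0" using h k by (auto simp: e_def)
  have he: "set_integrable lborel {0<..<e} h" "set_integrable lborel {0<..<e} k"
    by (rule set_integrable_subset[OF h(2)] set_integrable_subset[OF k(2)]; auto simp: e_def)+
  show "Im_integrable_germ (\<lambda>\<eta>. f \<eta> + g \<eta>)"
  proof (rule Im_integrable_germI[OF bounded.add[OF h(4) k(4)] e set_integral_add(1)[OF he]])
    show "\<forall>\<^sub>F \<eta> in at_right 0. \<bar>Im (f \<eta> + g \<eta>)\<bar> \<le> \<eta> * (h \<eta> + k \<eta>)"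
      using h(3) k(3) by eventually_elim (simp add: algebra_simps)
  qed
  show "Im_integrable_germ (\<lambda>\<eta>. f \<eta> * g \<eta>)"
  proof (rule Im_integrable_germI[OF bounded.mult[OF h(4) k(4)] e set_integral_add(1)])
    show "set_integrable lborel {0<..<e} (\<lambda>\<eta>. C * k \<eta>)" "set_integrable lborel {0<..<e} (\<lambda>\<eta>. D * h \<eta>)"
      using he by (auto intro!: set_integrable_mult_right)
    show "\<forall>\<^sub>F \<eta> in at_right 0. \<bar>Im (f \<eta> * g \<eta>)\<bar> \<le> \<eta> * (C * k \<eta> + D * h \<eta>)"
      using h(3) k(3) CD
    proof eventually_elim
      case (elim \<eta>)
      have "\<bar>Im (f \<eta> * g \<eta>)\<bar> \<le> \<bar>Re (f \<eta>)\<bar> * \<bar>Im (g \<eta>)\<bar> + \<bar>Re (g \<eta>)\<bar> * \<bar>Im (f \<eta>)\<bar>"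
        by (simp add: abs_mult[symmetric] mult.commute)
      also have "\<dots> \<le> C * (\<eta> * k \<eta>) + D * (\<eta> * h \<eta>)"
        using elim abs_Re_le_cmod[of "f \<eta>"] abs_Re_le_cmod[of "g \<eta>"]
        by (intro add_mono mult_mono) auto
      finally show ?case by (simp add: algebra_simps)
    qed
  qed
next
  fix f g :: "real \<Rightarrow> complex" assume "Im_integrable_germ f" and *: "\<forall>\<^sub>F \<eta> in at_right 0. g \<eta> = f \<eta>"
  then obtain h \<epsilon> where h: "\<epsilon> > 0" "set_integrable lborel {0<..<\<epsilon>} h" 
     "\<forall>\<^sub>F \<eta> in at_right 0. \<bar>Im (f \<eta>)\<bar> \<le> \<eta> * h \<eta>" "bounded_germ f"
    by (auto simp: Im_integrable_germ_def)
  show "Im_integrable_germ g"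
  proof (rule Im_integrable_germI[OF bounded.cong[OF h(4) *] h(1,2)])
    show "\<forall>\<^sub>F \<eta> in at_right 0. \<bar>Im (g \<eta>)\<bar> \<le> \<eta> * h \<eta>" using h(3) * by eventually_elim simp
  qed
next
  fix w assume w: "small_germ w"
  then obtain C where *: "\<forall>\<^sub>F \<eta> in at_right 0. cmod (w \<eta>) \<le> C * \<eta>" by (auto simp: small_germ_def)
  show "Im_integrable_germ w"
  proof (rule Im_integrable_germI[where \<epsilon>=1 and h="\<lambda>_. C"])
    show "set_integrable lborel {0<..<1::real} (\<lambda>_. C)"
      unfolding set_integrable_def by simp
    show "\<forall>\<^sub>F \<eta> in at_right 0. \<bar>Im (w \<eta>)\<bar> \<le> \<eta> * C"
      using *
    proof eventually_elim
      case (elim \<eta>)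
      then show ?case using abs_Im_le_cmod[of "w \<eta>"] by (simp add: mult.commute)
    qed
  qed (use w bounded.small in auto)
qed (simp add: Im_integrable_germ_def)

section \<open>Leading coefficients and reciprocals\<close>

lemma tendsto_small_germ:
  assumes "small_germ w"
  shows "(w \<longlongrightarrow> 0) (at_right 0)"
proof -
  obtain C where *: "\<forall>\<^sub>F \<eta> in at_right 0. cmod (w \<eta>) \<le> C * \<eta>"
    using assms by (auto simp: small_germ_def)
  have "((\<lambda>\<eta>. C * \<eta>) \<longlongrightarrow> C * 0) (at_right (0::real))" by (intro tendsto_intros)
  then show ?thesis using * by (intro Lim_null_comparison[of w "\<lambda>\<eta>. C * \<eta>"]) auto
qed

lemma tendsto_small_mult_bounded:
  assumes "small_germ w" "bounded_germ g"
  shows "((\<lambda>\<eta>. w \<eta> * g \<eta>) \<longlongrightarrow> 0) (at_right 0)"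
proof -
  obtain D where *: "\<forall>\<^sub>F \<eta> in at_right 0. cmod (g \<eta>) \<le> D"
    using assms by (auto simp: bounded_germ_def)
  have "((\<lambda>\<eta>. cmod (w \<eta>) * D) \<longlongrightarrow> 0) (at_right 0)"
    using tendsto_mult_right[OF tendsto_norm[OF tendsto_small_germ[OF assms(1)]], of D] by simp
  moreover have "\<forall>\<^sub>F \<eta> in at_right 0. cmod (w \<eta> * g \<eta>) \<le> cmod (w \<eta>) * D"
    using * by eventually_elim (simp add: norm_mult mult_left_mono)
  ultimately show ?thesis by (rule Lim_null_comparison[rotated])
qed

text \<open>The remainder is bounded, so \<open>w g\<close> tends to 0 and the leading coefficient
  can only be the limit of \<open>f\<close>. This later identifies coefficients with
  moments.\<close>

lemma (in germ_algebra) expansion_SucD: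
  assumes w: "small_germ w" and f: "expansion B w (Suc n) f" and lim: "(f \<longlongrightarrow> l) (at_right 0)"
  obtains a g where "l = of_real a" "expansion B w n g"
    "\<forall>\<^sub>F \<eta> in at_right 0. f \<eta> = of_real a + w \<eta> * g \<eta>"
proof -
  from f obtain a g where *: "expansion B w n g" "\<forall>\<^sub>F \<eta> in at_right 0. f \<eta> = of_real a + w \<eta> * g \<eta>"
    by auto
  have "((\<lambda>\<eta>. of_real a + w \<eta> * g \<eta>) \<longlongrightarrow> of_real a + 0) (at_right 0)"
    by (intro tendsto_add tendsto_const tendsto_small_mult_bounded w bounded expansion_base[OF w *(1)])
  then have "(f \<longlongrightarrow> of_real a) (at_right 0)"
    using tendsto_cong[OF *(2)] by simp
  then have "l = of_real a" using lim tendsto_unique trivial_limit_at_right_real by blast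
  then show ?thesis using that * by blast
qed

text \<open>From \<open>f = a + w g\<close> follows \<open>1/f = 1/a - w g / (a f)\<close>, where
  the reciprocal on the right is needed to one order less. In the base case the nonzero limit bounds
  \<open>1/f\<close>.\<close>

lemma expansion_inverse:
  assumes w: "small_germ w"
  shows "expansion bounded_germ w n f \<Longrightarrow> (f \<longlongrightarrow> l) (at_right 0) \<Longrightarrow> l \<noteq> 0 \<Longrightarrow>
    expansion bounded_germ w n (\<lambda>\<eta>. inverse (f \<eta>))"
proof (induction n)
  case 0
  then have "((\<lambda>\<eta>. inverse (f \<eta>)) \<longlongrightarrow> inverse l) (at_right 0)" by (intro tendsto_inverse)
  then have "((\<lambda>\<eta>. cmod (inverse (f \<eta>))) \<longlongrightarrow> cmod (inverse l)) (at_right 0)" by (rule tendsto_norm)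
  then have "\<forall>\<^sub>F \<eta> in at_right 0. cmod (inverse (f \<eta>)) < cmod (inverse l) + 1"
    by (rule order_tendstoD) simp
  then have "\<forall>\<^sub>F \<eta> in at_right 0. cmod (inverse (f \<eta>)) \<le> cmod (inverse l) + 1"
    by eventually_elim simp
  then show ?case by (auto simp: bounded_germ_def)
next
  case (Suc n)
  from bounded.expansion_SucD[OF w Suc.prems(1,2)] obtain a g where
    *: "l = of_real a" "expansion bounded_germ w n g"
      "\<forall>\<^sub>F \<eta> in at_right 0. f \<eta> = of_real a + w \<eta> * g \<eta>" by blast
  have nz: "\<forall>\<^sub>F \<eta> in at_right 0. f \<eta> \<noteq> 0"
    using Suc.prems(2,3) by (rule tendsto_imp_eventually_ne)
  have a: "a \<noteq> 0" using * Suc.prems by auto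
  define h where "h = (\<lambda>\<eta>. of_real (- 1 / a) * g \<eta> * inverse (f \<eta>))"
  have "expansion bounded_germ w n h" unfolding h_def
    using Suc.IH[OF bounded.expansion_Suc_lower[OF w Suc.prems(1)] Suc.prems(2,3)] *(2)
    by (intro bounded.expansion_mult w bounded.expansion_const)
  moreover have "\<forall>\<^sub>F \<eta> in at_right 0. inverse (f \<eta>) = of_real (1 / a) + w \<eta> * h \<eta>"
    using *(3) nz
  proof eventually_elim
    case (elim \<eta>)
    then have "w \<eta> * g \<eta> = f \<eta> - of_real a" by simp
    then have "w \<eta> * h \<eta> = of_real (-1/a) * (f \<eta> - of_real a) * inverse (f \<eta>)"
      unfolding h_def by (simp add: mult_ac)
    then show ?case using elim(2) a by (simp add: field_simps)
  qed
  ultimately show ?case by (rule expansion_SucI)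
qed

subsection \<open>The resolvent kernel in a cone\<close>

text \<open>Approach to 0 inside a fixed cone around the negative imaginary axis, with modulus
  comparable to \<open>\<eta>\<close>. Both \<open>z = -i \<eta>\<close> and its image
  \<open>G(1/z)\<close> qualify; the factor 2 leaves room for the deviation of the image.\<close>

definition cone_curve :: "(real \<Rightarrow> complex) \<Rightarrow> bool" where
  "cone_curve w \<longleftrightarrow> (\<forall>\<^sub>F \<eta> in at_right 0.
     \<bar>Re (w \<eta>)\<bar> \<le> - Im (w \<eta>) \<and> \<eta> \<le> - 2 * Im (w \<eta>) \<and> cmod (w \<eta>) \<le> \<eta>)"

lemma cone_curve_small: "cone_curve w \<Longrightarrow> small_germ w"
  unfolding cone_curve_def small_germ_def by (auto intro!: exI[of _ 1] elim: eventually_mono)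

text \<open>Since \<open>x\<^sup>2 \<le> y\<^sup>2\<close> in the cone, the difference of the two
  sides is at least \<open>3 - 8 t x + 6 (t x)\<^sup>2\<close>, a quadratic in \<open>t x\<close>
  with positive minimum. The kernel is thus controlled uniformly in \<open>t\<close>.\<close>

lemma norm_resolvent_ge:
  assumes "\<bar>Re w\<bar> \<le> - Im w"
  shows "1 + (t * cmod w)\<^sup>2 \<le> 4 * (cmod (1 - of_real t * w))\<^sup>2"
proof -
  define x y where "x = Re w" and "y = Im w"
  have "\<bar>x\<bar>\<^sup>2 \<le> (- y)\<^sup>2" using assms unfolding x_def y_def by (intro power_mono) auto
  then have xy: "t\<^sup>2 * x\<^sup>2 \<le> t\<^sup>2 * y\<^sup>2" by (intro mult_left_mono) auto
  have "3 - 8 * (t * x) + 6 * (t * x)\<^sup>2 = 6 * (t * x - 2/3)\<^sup>2 + 1/3"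
    by (simp add: power2_eq_square algebra_simps)
  then have "0 \<le> 3 - 8 * (t * x) + 6 * (t * x)\<^sup>2" by simp
  then have "0 \<le> 3 - 8 * (t * x) + 3 * (t\<^sup>2 * x\<^sup>2) + 3 * (t\<^sup>2 * y\<^sup>2)"
    using xy unfolding power_mult_distrib by linarith
  moreover have "(cmod (1 - of_real t * w))\<^sup>2 = 1 - 2 * (t * x) + t\<^sup>2 * x\<^sup>2 + t\<^sup>2 * y\<^sup>2"
    unfolding cmod_power2 x_def y_def by (simp add: power2_eq_square algebra_simps)
  moreover have "(t * cmod w)\<^sup>2 = t\<^sup>2 * x\<^sup>2 + t\<^sup>2 * y\<^sup>2"
    by (simp add: cmod_power2 x_def y_def power_mult_distrib distrib_left)
  ultimately show ?thesis by simp
qed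

lemma norm_resolvent_le: "(cmod (1 - of_real t * w))\<^sup>2 \<le> 2 * (1 + (t * cmod w)\<^sup>2)"
proof -
  have "cmod (1 - of_real t * w) \<le> 1 + \<bar>t\<bar> * cmod w"
    using norm_triangle_ineq4[of 1 "of_real t * w"] by (simp add: norm_mult)
  then have "(cmod (1 - of_real t * w))\<^sup>2 \<le> (1 + \<bar>t\<bar> * cmod w)\<^sup>2" by (intro power_mono) auto
  also have "\<dots> \<le> 2 * (1 + (\<bar>t\<bar> * cmod w)\<^sup>2)"
    using zero_le_power2[of "1 - \<bar>t\<bar> * cmod w"] by (simp add: power2_eq_square algebra_simps)
  finally show ?thesis by (simp add: power_mult_distrib)
qed

lemma resolvent_nonzero:
  assumes "\<bar>Re w\<bar> \<le> - Im w"
  shows "1 - of_real t * w \<noteq> 0"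
proof
  assume "1 - of_real t * w = 0"
  then show False using norm_resolvent_ge[OF assms, of t] by simp (smt (verit) zero_le_power2)
qed

lemma norm_resolvent_bound:
  assumes "\<bar>Re w\<bar> \<le> - Im w"
  shows "1 \<le> 2 * cmod (1 - of_real t * w)" "\<bar>t\<bar> * cmod w \<le> 2 * cmod (1 - of_real t * w)"
proof -
  have *: "1 + (t * cmod w)\<^sup>2 \<le> (2 * cmod (1 - of_real t * w))\<^sup>2"
    using norm_resolvent_ge[OF assms, of t] by (simp add: power_mult_distrib)
  have "1\<^sup>2 \<le> (2 * cmod (1 - of_real t * w))\<^sup>2" using * by (smt (verit) zero_le_power2 one_power2)
  then show "1 \<le> 2 * cmod (1 - of_real t * w)" by (rule power2_le_imp_le) simp
  have "(\<bar>t\<bar> * cmod w)\<^sup>2 \<le> (2 * cmod (1 - of_real t * w))\<^sup>2" using * by (simp add: power_mult_distrib)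
  then show "\<bar>t\<bar> * cmod w \<le> 2 * cmod (1 - of_real t * w)" by (rule power2_le_imp_le) simp
qed

lemma norm_resolvent_kernel:
  assumes "\<bar>Re w\<bar> \<le> - Im w"
  shows "cmod (of_real (t ^ j) / (1 - of_real t * w)) \<le> 2 * \<bar>t\<bar> ^ j"
proof -
  have pos: "0 < cmod (1 - of_real t * w)" using norm_resolvent_bound(1)[OF assms, of t] by linarith
  have "\<bar>t\<bar> ^ j * 1 \<le> \<bar>t\<bar> ^ j * (2 * cmod (1 - of_real t * w))"
    using norm_resolvent_bound(1)[OF assms, of t] by (intro mult_left_mono) auto
  then show ?thesis using pos by (simp add: norm_divide norm_power divide_le_eq mult_ac)
qed

text \<open>The extra power of \<open>t\<close> is paid for by \<open>1 / |w|\<close>, so the kernel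
  of order \<open>j + 1\<close> is integrable as soon as the moment of order \<open>j\<close>
  exists.\<close>

lemma norm_resolvent_kernel_Suc:
  assumes "\<bar>Re w\<bar> \<le> - Im w" "w \<noteq> 0"
  shows "cmod (of_real (t ^ Suc j) / (1 - of_real t * w)) \<le> 2 * \<bar>t\<bar> ^ j / cmod w"
proof -
  have pos: "0 < cmod (1 - of_real t * w)" using norm_resolvent_bound(1)[OF assms(1), of t] by linarith
  have "\<bar>t\<bar> ^ j * (\<bar>t\<bar> * cmod w) \<le> \<bar>t\<bar> ^ j * (2 * cmod (1 - of_real t * w))"
    using norm_resolvent_bound(2)[OF assms(1), of t] by (intro mult_left_mono) auto
  then show ?thesis using pos assms(2)
    by (simp add: norm_divide norm_power norm_mult field_simps)
qed

text \<open>Together with \<open>resolvent_weight_le\<close>, replaces the weight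
  \<open>1 / |1 - t w|\<^sup>2\<close>, up to constants, by one that depends on
  \<open>\<eta>\<close> but not on the curve and has an explicit integral over
  \<open>\<eta>\<close>.\<close>

lemma resolvent_weight_ge:
  assumes "\<eta> > 0" "\<bar>Re w\<bar> \<le> - Im w" "cmod w \<le> \<eta>"
  shows "1 / (1 + (t * \<eta>)\<^sup>2) \<le> 2 / (cmod (1 - of_real t * w))\<^sup>2"
proof -
  have "(t * cmod w)\<^sup>2 \<le> (t * \<eta>)\<^sup>2"
    unfolding power_mult_distrib using assms by (intro mult_left_mono power_mono) auto
  then have "(cmod (1 - of_real t * w))\<^sup>2 \<le> 2 * (1 + (t * \<eta>)\<^sup>2)"
    by (intro order_trans[OF norm_resolvent_le]) simp
  moreover have "0 < (cmod (1 - of_real t * w))\<^sup>2" using resolvent_nonzero[OF assms(2), of t] by simp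
  moreover have "0 < 1 + (t * \<eta>)\<^sup>2" by (simp add: add_pos_nonneg)
  ultimately show ?thesis by (simp add: field_simps)
qed

lemma resolvent_weight_le:
  assumes "\<eta> > 0" "\<bar>Re w\<bar> \<le> - Im w" "\<eta> \<le> - 2 * Im w"
  shows "1 / (cmod (1 - of_real t * w))\<^sup>2 \<le> 16 / (1 + (t * \<eta>)\<^sup>2)"
proof -
  have "\<eta> \<le> 2 * cmod w" using assms abs_Im_le_cmod[of w] by linarith
  then have "(t * \<eta>)\<^sup>2 \<le> (t * (2 * cmod w))\<^sup>2"
    unfolding power_mult_distrib[of t] using assms by (intro mult_left_mono power_mono) auto
  then have "1 + (t * \<eta>)\<^sup>2 \<le> 16 * (cmod (1 - of_real t * w))\<^sup>2"
    using norm_resolvent_ge[OF assms(2), of t] by (simp add: power_mult_distrib)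
  moreover have "0 < (cmod (1 - of_real t * w))\<^sup>2" using resolvent_nonzero[OF assms(2), of t] by simp
  moreover have "0 < 1 + (t * \<eta>)\<^sup>2" by (simp add: add_pos_nonneg)
  ultimately show ?thesis by (simp add: field_simps)
qed

lemma Im_resolvent: "Im (1 / (1 - of_real t * w)) = t * Im w / (cmod (1 - of_real t * w))\<^sup>2"
  by (simp add: Im_divide cmod_power2)

lemma Re_resolvent: "Re (1 / (1 - of_real t * w)) = (1 - t * Re w) / (cmod (1 - of_real t * w))\<^sup>2"
  by (simp add: Re_divide cmod_power2)

lemma Re_of_real_mult: "Re (of_real r * z) = r * Re z"
  by simp

lemma Im_of_real_mult: "Im (of_real r * z) = r * Im z"
  by simp

section \<open>Moments of the resolvent kernel\<close>

text \<open>For \<open>j = 0\<close> this is the moment generating function \<open>M\<close>; for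
  larger \<open>j\<close> it is formally the remainder of \<open>M\<close> after \<open>j\<close>
  terms, divided by \<open>w^j\<close>.\<close>

definition resolvent_moment :: "real measure \<Rightarrow> nat \<Rightarrow> complex \<Rightarrow> complex" where
  "resolvent_moment M j w = (LINT t|M. of_real (t ^ j) / (1 - of_real t * w))"

text \<open>Fatou's lemma along \<open>\<eta> = 1/(n+1)\<close>, where the weights tend to
  1.\<close>

lemma (in finite_measure) integrable_if_pole_weighted_bounded:
  fixes f g :: "'a \<Rightarrow> real"
  assumes f[measurable]: "f \<in> borel_measurable M" and g[measurable]: "g \<in> borel_measurable M"
    and nn: "\<And>t. 0 \<le> f t"
    and ev: "\<forall>\<^sub>F \<eta> in at_right 0. integrable M (\<lambda>t. f t / (1 + (g t * \<eta>)\<^sup>2)) \<and>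
               (LINT t|M. f t / (1 + (g t * \<eta>)\<^sup>2)) \<le> C"
  shows "integrable M f"
proof -
  define x where "x n = inverse (real (Suc n))" for n
  have x0: "x \<longlonglongrightarrow> 0" unfolding x_def by (rule LIMSEQ_inverse_real_of_nat)
  have "filterlim x (at_right 0) sequentially"
    using x0 unfolding filterlim_at by (auto simp: x_def)
  then have ev': "\<forall>\<^sub>F n in sequentially. integrable M (\<lambda>t. f t / (1 + (g t * x n)\<^sup>2)) \<and>
               (LINT t|M. f t / (1 + (g t * x n)\<^sup>2)) \<le> C"
    using ev by (auto simp: filterlim_iff)
  let ?u = "\<lambda>n t. ennreal (f t / (1 + (g t * x n)\<^sup>2))"
  have lim: "(\<lambda>n. ?u n t) \<longlonglongrightarrow> ennreal (f t)" for t
  proof -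
    have "(\<lambda>n. f t / (1 + (g t * x n)\<^sup>2)) \<longlonglongrightarrow> f t / (1 + (g t * 0)\<^sup>2)"
      by (intro tendsto_intros x0) simp
    then show ?thesis by (intro tendsto_ennrealI) simp
  qed
  have "(\<integral>\<^sup>+ t. ennreal (f t) \<partial>M) = (\<integral>\<^sup>+ t. liminf (\<lambda>n. ?u n t) \<partial>M)"
    using lim_imp_Liminf[OF _ lim] by simp
  also have "\<dots> \<le> liminf (\<lambda>n. \<integral>\<^sup>+ t. ?u n t \<partial>M)" by (rule nn_integral_liminf) simp
  also have "\<dots> \<le> limsup (\<lambda>n. \<integral>\<^sup>+ t. ?u n t \<partial>M)" by (rule Liminf_le_Limsup) simp
  also have "\<dots> \<le> ennreal C"
  proof (rule Limsup_bounded)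
    show "\<forall>\<^sub>F n in sequentially. (\<integral>\<^sup>+ t. ?u n t \<partial>M) \<le> ennreal C"
      using ev'
    proof eventually_elim
      case (elim n)
      then have "(\<integral>\<^sup>+ t. ?u n t \<partial>M) = ennreal (LINT t|M. f t / (1 + (g t * x n)\<^sup>2))"
        using nn by (intro nn_integral_eq_integral) auto
      with elim show ?case by (simp add: ennreal_leI)
    qed
  qed
  finally have "(\<integral>\<^sup>+ t. ennreal (norm (f t)) \<partial>M) < \<infinity>" using nn by (simp add: le_less_trans)
  then show ?thesis by (intro integrableI_bounded) auto
qed

context finite_borel_measure
begin

lemmas [measurable_cong] = M_is_borel

lemma admits_moment_iff: "admits_moment M p \<longleftrightarrow> integrable M (\<lambda>t. t ^ p)"
  unfolding admits_moment_def power_abs[symmetric]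
  by (rule iffI) (auto dest: integrable_abs intro: Bochner_Integration.integrable_bound)

lemma admits_moment_lower:
  assumes "admits_moment M p" "j \<le> p"
  shows "admits_moment M j"
  unfolding admits_moment_def
proof (rule Bochner_Integration.integrable_bound)
  show "integrable M (\<lambda>t. 1 + \<bar>t\<bar> ^ p)" using assms by (simp add: admits_moment_def)
  have "\<bar>t\<bar> ^ j \<le> 1 + \<bar>t\<bar> ^ p" for t :: real
  proof (cases "\<bar>t\<bar> \<le> 1")
    case True
    then have "\<bar>t\<bar> ^ j \<le> 1" by (intro power_le_one) auto
    then show ?thesis using zero_le_power_abs[of t p] by linarith
  next
    case False
    then have "\<bar>t\<bar> ^ j \<le> \<bar>t\<bar> ^ p" using assms by (intro power_increasing) auto
    then show ?thesis by simp
  qed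
  then show "AE t in M. norm (\<bar>t\<bar> ^ j) \<le> norm (1 + \<bar>t\<bar> ^ p)" by (intro AE_I2) (simp add: power_abs)
qed simp

lemma integrable_resolvent_kernel:
  assumes "admits_moment M j" "\<bar>Re w\<bar> \<le> - Im w"
  shows "integrable M (\<lambda>t. of_real (t ^ j) / (1 - of_real t * w) :: complex)"
proof (rule Bochner_Integration.integrable_bound)
  show "integrable M (\<lambda>t. 2 * \<bar>t\<bar> ^ j)" using assms by (simp add: admits_moment_def)
  show "AE t in M. cmod (of_real (t ^ j) / (1 - of_real t * w)) \<le> norm (2 * \<bar>t\<bar> ^ j)"
    using norm_resolvent_kernel[OF assms(2)] by (intro AE_I2) simp
qed simp

lemma integrable_resolvent_kernel_Suc:
  assumes "admits_moment M j" "\<bar>Re w\<bar> \<le> - Im w" "w \<noteq> 0"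
  shows "integrable M (\<lambda>t. of_real (t ^ Suc j) / (1 - of_real t * w) :: complex)"
proof (rule Bochner_Integration.integrable_bound)
  show "integrable M (\<lambda>t. 2 * \<bar>t\<bar> ^ j / cmod w)" using assms by (simp add: admits_moment_def)
  show "AE t in M. cmod (of_real (t ^ Suc j) / (1 - of_real t * w)) \<le> norm (2 * \<bar>t\<bar> ^ j / cmod w)"
    using norm_resolvent_kernel_Suc[OF assms(2,3)] by (intro AE_I2) simp
qed simp

lemma norm_resolvent_moment_le:
  assumes "admits_moment M j" "\<bar>Re w\<bar> \<le> - Im w"
  shows "cmod (resolvent_moment M j w) \<le> 2 * (LINT t|M. \<bar>t\<bar> ^ j)"
proof -
  have "cmod (resolvent_moment M j w) \<le> (LINT t|M. 2 * \<bar>t\<bar> ^ j)"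
    unfolding resolvent_moment_def
  proof (rule Bochner_Integration.integral_norm_bound_integral)
    show "integrable M (\<lambda>t. 2 * \<bar>t\<bar> ^ j)" using assms by (simp add: admits_moment_def)
  qed (use assms integrable_resolvent_kernel norm_resolvent_kernel in blast)+
  then show ?thesis by simp
qed

text \<open>Integrates \<open>t^j / (1 - t w) = t^j + w t^(j+1) / (1 - t w)\<close>, which peels off
  one moment; for fixed \<open>w \<noteq> 0\<close> the moment of order \<open>j\<close> alone makes
  both integrals exist.\<close>

lemma resolvent_moment_rec:
  assumes "admits_moment M j" "\<bar>Re w\<bar> \<le> - Im w" "w \<noteq> 0"
  shows "resolvent_moment M j w = of_real (LINT t|M. t ^ j) + w * resolvent_moment M (Suc j) w"
proof -
  have "resolvent_moment M j w =
      (LINT t|M. complex_of_real (t ^ j) + w * (of_real (t ^ Suc j) / (1 - of_real t * w)))"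
    unfolding resolvent_moment_def
  proof (rule Bochner_Integration.integral_cong[OF refl])
    fix t
    show "complex_of_real (t ^ j) / (1 - of_real t * w)
      = complex_of_real (t ^ j) + w * (of_real (t ^ Suc j) / (1 - of_real t * w))"
      using resolvent_nonzero[OF assms(2), of t] by (simp add: field_simps)
  qed
  also have "\<dots> = (LINT t|M. complex_of_real (t ^ j)) + (LINT t|M. w * (of_real (t ^ Suc j) / (1 - of_real t * w)))"
    using integrable_resolvent_kernel_Suc[OF assms] assms(1)
    by (intro Bochner_Integration.integral_add integrable_mult_right integrable_of_real) (auto simp: admits_moment_iff)
  also have "\<dots> = of_real (LINT t|M. t ^ j) + w * resolvent_moment M (Suc j) w"
    by (simp only: integral_complex_of_real integral_mult_right_zero resolvent_moment_def)
  finally show ?thesis .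
qed

lemma eventually_resolvent_moment_rec:
  assumes "admits_moment M j" "cone_curve w"
  shows "\<forall>\<^sub>F \<eta> in at_right 0. resolvent_moment M j (w \<eta>) =
    of_real (LINT t|M. t ^ j) + w \<eta> * resolvent_moment M (Suc j) (w \<eta>)"
  using assms(2)[unfolded cone_curve_def] eventually_at_right_less[of "0::real"]
proof eventually_elim
  case (elim \<eta>)
  then have "w \<eta> \<noteq> 0" by auto
  with elim show ?case using resolvent_moment_rec[OF assms(1)] by blast
qed

lemma bounded_germ_resolvent_moment:
  assumes "admits_moment M j" "cone_curve w"
  shows "bounded_germ (\<lambda>\<eta>. resolvent_moment M j (w \<eta>))"
  unfolding bounded_germ_def
proof (intro exI)
  show "\<forall>\<^sub>F \<eta> in at_right 0. cmod (resolvent_moment M j (w \<eta>)) \<le> 2 * (LINT t|M. \<bar>t\<bar> ^ j)"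
    using assms(2)[unfolded cone_curve_def]
    by eventually_elim (use norm_resolvent_moment_le[OF assms(1)] in blast)
qed

lemma tendsto_resolvent_moment:
  assumes mom: "admits_moment M j" and w: "cone_curve w"
  shows "((\<lambda>\<eta>. resolvent_moment M j (w \<eta>)) \<longlongrightarrow> of_real (LINT t|M. t ^ j)) (at_right 0)"
  \<comment> \<open>The substitution \<open>\<eta> = 1/i\<close> moves the limit to infinity, where
    dominated convergence applies with majorant \<open>2 |t|^j\<close>.\<close>
  unfolding filterlim_at_right_to_top resolvent_moment_def integral_complex_of_real[symmetric]
proof (rule integral_dominated_convergence_at_top)
  show "integrable M (\<lambda>t. 2 * \<bar>t\<bar> ^ j)" using mom by (simp add: admits_moment_def)
  have "((\<lambda>\<eta>. of_real (t ^ j) / (1 - of_real t * w \<eta>)) \<longlongrightarrow> of_real (t ^ j) / (1 - of_real t * 0)) (at_right 0)" for t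
    by (intro tendsto_intros tendsto_small_germ cone_curve_small w) simp
  then have "((\<lambda>i. of_real (t ^ j) / (1 - of_real t * w (inverse i))) \<longlongrightarrow> complex_of_real (t ^ j)) at_top" for t
    unfolding filterlim_at_right_to_top by simp
  then show "AE t in M. ((\<lambda>i. of_real (t ^ j) / (1 - of_real t * w (inverse i))) \<longlongrightarrow> complex_of_real (t ^ j)) at_top"
    by simp
  have "\<forall>\<^sub>F \<eta> in at_right 0. AE t in M. cmod (of_real (t ^ j) / (1 - of_real t * w \<eta>)) \<le> 2 * \<bar>t\<bar> ^ j"
    using w[unfolded cone_curve_def] 
    by eventually_elim (use norm_resolvent_kernel in \<open>blast intro: AE_I2\<close>)
  then show "\<forall>\<^sub>F i in at_top. AE t in M. cmod (of_real (t ^ j) / (1 - of_real t * w (inverse i))) \<le> 2 * \<bar>t\<bar> ^ j"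
    by (simp add: eventually_at_right_to_top)
qed simp_all

text \<open>Taking imaginary parts gains a further power of \<open>t\<close>. For even
  \<open>j\<close> the new integrand is nonnegative, so no cancellation can hide the size of the
  tails.\<close>

lemma Im_resolvent_moment:
  assumes "admits_moment M j" "\<bar>Re w\<bar> \<le> - Im w" "w \<noteq> 0"
  shows "integrable M (\<lambda>t. t ^ (j + 2) / (cmod (1 - of_real t * w))\<^sup>2)" (is "integrable M ?f")
    and "Im (resolvent_moment M (Suc j) w) = Im w * (LINT t|M. t ^ (j + 2) / (cmod (1 - of_real t * w))\<^sup>2)"
proof -
  have eq: "Im (of_real (t ^ Suc j) / (1 - of_real t * w)) = Im w * ?f t" for t
  proof -
    have "Im (of_real (t ^ Suc j) / (1 - of_real t * w)) = t ^ Suc j * Im (1 / (1 - of_real t * w))"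
      by (metis Im_complex_of_real Re_complex_of_real add_0 add.right_neutral mult.right_neutral
          mult_zero_left times_complex.simps(2) times_divide_eq_right)
    then show ?thesis unfolding Im_resolvent by simp
  qed
  have neg: "Im w \<noteq> 0" using assms(2,3) by (auto simp: complex_eq_iff)
  have "integrable M (\<lambda>t. Im w * ?f t)"
    using integrable_Im[OF integrable_resolvent_kernel_Suc[OF assms]] unfolding eq .
  then show "integrable M ?f" using neg by (simp only: integrable_mult_left_iff simp_thms)
  show "Im (resolvent_moment M (Suc j) w) = Im w * (LINT t|M. ?f t)"
    unfolding resolvent_moment_def integral_Im[OF integrable_resolvent_kernel_Suc[OF assms], symmetric] eq
    by (rule integral_mult_right_zero)
qed

subsection \<open>Moments and expansions of the resolvent moments\<close>

lemma resolvent_moment_cong_germ: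
  assumes "admits_moment M j" "cone_curve w"
    and "\<forall>\<^sub>F \<eta> in at_right 0. resolvent_moment M j (w \<eta>) = of_real (LINT t|M. t ^ j) + w \<eta> * g \<eta>"
  shows "\<forall>\<^sub>F \<eta> in at_right 0. resolvent_moment M (Suc j) (w \<eta>) = g \<eta>"
  using assms(2)[unfolded cone_curve_def] eventually_resolvent_moment_rec[OF assms(1,2)] assms(3)
    eventually_at_right_less[of "0::real"]
proof eventually_elim
  case (elim \<eta>)
  then have "w \<eta> \<noteq> 0" by auto
  then show ?case using elim(2,3) by simp
qed

text \<open>Iterates the recursion downwards from order \<open>p\<close>; only the last remainder
  has to be known to lie in \<open>B\<close>.\<close>

lemma expansion_resolvent_moment:
  assumes "germ_algebra B" "cone_curve w" "admits_moment M p" "B (\<lambda>\<eta>. resolvent_moment M p (w \<eta>))"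
  shows "n \<le> p \<Longrightarrow> expansion B w n (\<lambda>\<eta>. resolvent_moment M (p - n) (w \<eta>))"
proof (induction n)
  case (Suc n)
  then have eq: "Suc (p - Suc n) = p - n" by simp
  have "\<forall>\<^sub>F \<eta> in at_right 0. resolvent_moment M (p - Suc n) (w \<eta>)
     = of_real (LINT t|M. t ^ (p - Suc n)) + w \<eta> * resolvent_moment M (p - n) (w \<eta>)"
    using eventually_resolvent_moment_rec[OF admits_moment_lower[OF assms(3)] assms(2), of "p - Suc n"]
    unfolding eq by simp
  then show ?case using Suc by (intro expansion_SucI) auto
qed (use assms in simp)

text \<open>The leading coefficient is forced to be the moment of order \<open>m\<close>;
  subtracting it and dividing by \<open>w\<close> leaves the next resolvent moment.\<close>

lemma expansion_resolvent_moment_Suc: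
  assumes "germ_algebra B" "cone_curve w" "admits_moment M m"
    and "expansion B w (Suc n) (\<lambda>\<eta>. resolvent_moment M m (w \<eta>))"
  shows "expansion B w n (\<lambda>\<eta>. resolvent_moment M (Suc m) (w \<eta>))"
proof -
  interpret germ_algebra B by fact
  obtain a g where *: "complex_of_real (LINT t|M. t ^ m) = of_real a" "expansion B w n g"
    "\<forall>\<^sub>F \<eta> in at_right 0. resolvent_moment M m (w \<eta>) = of_real a + w \<eta> * g \<eta>"
    using expansion_SucD[OF cone_curve_small[OF assms(2)] assms(4) tendsto_resolvent_moment[OF assms(3,2)]] .
  show ?thesis
    using expansion_cong[OF *(2)] resolvent_moment_cong_germ[OF assms(3,2)] *(1,3) by simp
qed

lemma expansion_resolvent_moment_drop:
  assumes "germ_algebra B" "cone_curve w" 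
  shows "admits_moment M m \<Longrightarrow> expansion B w (Suc m + n) (\<lambda>\<eta>. resolvent_moment M 0 (w \<eta>)) \<Longrightarrow>
    expansion B w n (\<lambda>\<eta>. resolvent_moment M (Suc m) (w \<eta>))"
proof (induction m arbitrary: n)
  case 0
  then show ?case using expansion_resolvent_moment_Suc[OF assms] by simp
next
  case (Suc m)
  have "expansion B w (Suc n) (\<lambda>\<eta>. resolvent_moment M (Suc m) (w \<eta>))"
    using Suc.IH[of "Suc n"] Suc.prems admits_moment_lower[of "Suc m" m] by simp
  then show ?case using expansion_resolvent_moment_Suc[OF assms Suc.prems(1)] by blast
qed

section \<open>Moments from imaginary parts of remainders\<close>

lemma integrable_pole_weight:
  assumes "admits_moment M j" "\<eta> > 0"
  shows "integrable M (\<lambda>t. \<bar>t\<bar> ^ (j + 2) / (1 + (t * \<eta>)\<^sup>2))"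
proof (rule Bochner_Integration.integrable_bound)
  show "integrable M (\<lambda>t. \<bar>t\<bar> ^ j / \<eta>\<^sup>2)" using assms by (simp add: admits_moment_def)
  have "\<bar>t\<bar> ^ (j + 2) / (1 + (t * \<eta>)\<^sup>2) \<le> \<bar>t\<bar> ^ j / \<eta>\<^sup>2" for t
  proof -
    have "\<bar>t\<bar> ^ (j + 2) = \<bar>t\<bar> ^ j / \<eta>\<^sup>2 * (t * \<eta>)\<^sup>2"
      unfolding power_add using assms(2) by (simp add: power_mult_distrib)
    also have "\<dots> \<le> \<bar>t\<bar> ^ j / \<eta>\<^sup>2 * (1 + (t * \<eta>)\<^sup>2)" by (intro mult_left_mono) auto
    finally show ?thesis by (subst pos_divide_le_eq) (auto intro: add_pos_nonneg)
  qed
  then show "AE t in M. norm (\<bar>t\<bar> ^ (j + 2) / (1 + (t * \<eta>)\<^sup>2)) \<le> norm (\<bar>t\<bar> ^ j / \<eta>\<^sup>2)" by (intro AE_I2) simp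
qed simp

text \<open>Compares weights under the integral of \<open>Im_resolvent_moment\<close>, whose
  integrand is nonnegative as \<open>j\<close> is even. One factor 2 of the constant comes from the
  weights, the other from \<open>\<eta> \<le> - 2 * Im w\<close>.\<close>

lemma pole_weight_Im_le:
  assumes "even j" "admits_moment M j" "\<eta> > 0"
    and "\<bar>Re w\<bar> \<le> - Im w" "\<eta> \<le> - 2 * Im w" "cmod w \<le> \<eta>"
  shows "\<eta> * (LINT t|M. \<bar>t\<bar> ^ (j + 2) / (1 + (t * \<eta>)\<^sup>2)) \<le> 4 * \<bar>Im (resolvent_moment M (Suc j) w)\<bar>"
proof -
  have w0: "w \<noteq> 0" using assms(3,5) by auto
  have abs_pow: "\<bar>t\<bar> ^ (j + 2) = t ^ (j + 2)" for t :: real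
    using assms(1) by (intro power_even_abs) simp
  define I where "I = (LINT t|M. t ^ (j + 2) / (cmod (1 - of_real t * w))\<^sup>2)"
  have Inn: "0 \<le> I" unfolding I_def using assms(1)
    by (intro integral_nonneg_AE AE_I2 divide_nonneg_nonneg zero_le_even_power) auto
  have "(LINT t|M. \<bar>t\<bar> ^ (j + 2) / (1 + (t * \<eta>)\<^sup>2)) \<le> (LINT t|M. 2 * (t ^ (j + 2) / (cmod (1 - of_real t * w))\<^sup>2))"
  proof (rule integral_mono)
    fix t
    show "\<bar>t\<bar> ^ (j + 2) / (1 + (t * \<eta>)\<^sup>2) \<le> 2 * (t ^ (j + 2) / (cmod (1 - of_real t * w))\<^sup>2)"
      using mult_left_mono[OF resolvent_weight_ge[OF assms(3,4,6)] zero_le_power_abs[of t "j + 2"], of t]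
      by (simp only: abs_pow times_divide_eq_right mult.commute mult_1_left mult_1_right)
  qed (intro integrable_mult_right integrable_pole_weight[OF assms(2,3)] Im_resolvent_moment(1)[OF assms(2,4) w0])+
  then have *: "(LINT t|M. \<bar>t\<bar> ^ (j + 2) / (1 + (t * \<eta>)\<^sup>2)) \<le> 2 * I"
    by (simp only: I_def integral_mult_right_zero)
  have "\<eta> * (LINT t|M. \<bar>t\<bar> ^ (j + 2) / (1 + (t * \<eta>)\<^sup>2)) \<le> (- 2 * Im w) * (2 * I)"
    using assms(3,5) * Inn by (intro mult_mono integral_nonneg_AE AE_I2) auto
  also have "\<dots> = 4 * \<bar>Im w * I\<bar>" using assms(3,5) Inn by (simp add: abs_mult)
  also have "Im w * I = Im (resolvent_moment M (Suc j) w)"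
    using Im_resolvent_moment(2)[OF assms(2,4) w0] unfolding I_def by simp
  finally show ?thesis .
qed

lemma Im_le_pole_weight:
  assumes "even j" "admits_moment M j" "\<eta> > 0"
    and "\<bar>Re w\<bar> \<le> - Im w" "\<eta> \<le> - 2 * Im w" "cmod w \<le> \<eta>"
  shows "\<bar>Im (resolvent_moment M (Suc j) w)\<bar> \<le> \<eta> * (16 * (LINT t|M. \<bar>t\<bar> ^ (j + 2) / (1 + (t * \<eta>)\<^sup>2)))"
proof -
  have w0: "w \<noteq> 0" using assms(3,5) by auto
  have abs_pow: "\<bar>t\<bar> ^ (j + 2) = t ^ (j + 2)" for t :: real
    using assms(1) by (intro power_even_abs) simp
  define I where "I = (LINT t|M. t ^ (j + 2) / (cmod (1 - of_real t * w))\<^sup>2)"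
  have Inn: "0 \<le> I" unfolding I_def using assms(1)
    by (intro integral_nonneg_AE AE_I2 divide_nonneg_nonneg zero_le_even_power) auto
  have "I \<le> (LINT t|M. 16 * (\<bar>t\<bar> ^ (j + 2) / (1 + (t * \<eta>)\<^sup>2)))" unfolding I_def
  proof (rule integral_mono)
    fix t
    show "t ^ (j + 2) / (cmod (1 - of_real t * w))\<^sup>2 \<le> 16 * (\<bar>t\<bar> ^ (j + 2) / (1 + (t * \<eta>)\<^sup>2))"
      using mult_left_mono[OF resolvent_weight_le[OF assms(3-5)] zero_le_power_abs[of t "j + 2"], of t]
      by (simp only: abs_pow times_divide_eq_right mult.commute mult_1_left mult_1_right)
  qed (intro integrable_mult_right integrable_pole_weight[OF assms(2,3)] Im_resolvent_moment(1)[OF assms(2,4) w0])+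
  then have *: "I \<le> 16 * (LINT t|M. \<bar>t\<bar> ^ (j + 2) / (1 + (t * \<eta>)\<^sup>2))"
    by (simp only: integral_mult_right_zero)
  have "\<bar>Im (resolvent_moment M (Suc j) w)\<bar> = \<bar>Im w\<bar> * I"
    using Im_resolvent_moment(2)[OF assms(2,4) w0] Inn unfolding I_def[symmetric] by (simp add: abs_mult)
  also have "\<dots> \<le> \<eta> * (16 * (LINT t|M. \<bar>t\<bar> ^ (j + 2) / (1 + (t * \<eta>)\<^sup>2)))"
    using assms(3,6) * Inn abs_Im_le_cmod[of w] by (intro mult_mono) auto
  finally show ?thesis .
qed

text \<open>The real coefficient disappears from the imaginary part, which is therefore
  \<open>O(\<eta>)\<close>; dividing by \<open>\<eta>\<close> bounds the weighted moments of order
  \<open>j + 2\<close>, and Fatou removes the weight.\<close>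

lemma admits_moment_even_step:
  assumes "even j" "admits_moment M j" "cone_curve w"
    and "expansion bounded_germ w 1 (\<lambda>\<eta>. resolvent_moment M (Suc j) (w \<eta>))"
  shows "admits_moment M (j + 2)"
proof -
  obtain b h where h: "bounded_germ h"
    "\<forall>\<^sub>F \<eta> in at_right 0. resolvent_moment M (Suc j) (w \<eta>) = of_real b + w \<eta> * h \<eta>"
    using assms(4) by auto
  obtain C where C: "\<forall>\<^sub>F \<eta> in at_right 0. cmod (h \<eta>) \<le> C" using h(1) by (auto simp: bounded_germ_def)
  have "\<forall>\<^sub>F \<eta> in at_right 0. integrable M (\<lambda>t. \<bar>t\<bar> ^ (j + 2) / (1 + (t * \<eta>)\<^sup>2)) \<and>
      (LINT t|M. \<bar>t\<bar> ^ (j + 2) / (1 + (t * \<eta>)\<^sup>2)) \<le> 4 * C"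
    using assms(3)[unfolded cone_curve_def] h(2) C eventually_at_right_less[of "0::real"]
  proof eventually_elim
    case (elim \<eta>)
    have "\<bar>Im (resolvent_moment M (Suc j) (w \<eta>))\<bar> = \<bar>Im (w \<eta> * h \<eta>)\<bar>" using elim by simp
    also have "\<dots> \<le> cmod (w \<eta> * h \<eta>)" by (rule abs_Im_le_cmod)
    also have "\<dots> \<le> \<eta> * C" unfolding norm_mult using elim by (intro mult_mono) auto
    finally have "\<eta> * (LINT t|M. \<bar>t\<bar> ^ (j + 2) / (1 + (t * \<eta>)\<^sup>2)) \<le> \<eta> * (4 * C)"
      using pole_weight_Im_le[OF assms(1,2), of \<eta> "w \<eta>"] elim by linarith
    then show ?case using elim integrable_pole_weight[OF assms(2)] by simp
  qed
  then show ?thesis unfolding admits_moment_def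
    by (intro integrable_if_pole_weighted_bounded[where g="\<lambda>t. t"]) auto
qed

text \<open>Hamburger's induction in steps of two: of \<open>2 k + 2\<close> terms,
  \<open>2 k + 1\<close> are used up by the moments of orders 0 to \<open>2 k\<close>, and one is
  left for \<open>admits_moment_even_step\<close>.\<close>

lemma admits_even_moment_if_expansion:
  assumes "cone_curve w"
  shows "expansion bounded_germ w (2 * k) (\<lambda>\<eta>. resolvent_moment M 0 (w \<eta>)) \<Longrightarrow> admits_moment M (2 * k)"
proof (induction k)
  case 0
  then show ?case by (simp add: admits_moment_def)
next
  case (Suc k)
  note small = cone_curve_small[OF assms]
  have k: "admits_moment M (2 * k)"
    using Suc.IH bounded.expansion_lower[OF small Suc.prems, of "2 * k"] by simp
  have "expansion bounded_germ w 1 (\<lambda>\<eta>. resolvent_moment M (Suc (2 * k)) (w \<eta>))"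
    using expansion_resolvent_moment_drop[OF bounded.germ_algebra_axioms assms k, of 1] Suc.prems by simp
  then show ?case using admits_moment_even_step[OF _ k assms] by simp
qed

text \<open>By Tonelli the integral over \<open>\<eta>\<close> is done first, with antiderivative
  \<open>|t|^(j+1) arctan (|t| \<eta>)\<close>. As \<open>arctan\<close> is bounded, and
  \<open>arctan (|t| \<epsilon>)\<close> is bounded below for \<open>|t| \<ge> 1\<close>, the result
  is finite exactly when the moment of order \<open>j + 1\<close> is.\<close>

lemma nn_integral_pole_weight:
  assumes "\<epsilon> > 0"
  shows "(\<integral>\<^sup>+ \<eta>. (\<integral>\<^sup>+ t. ennreal (\<bar>t\<bar> ^ (j + 2) / (1 + (t * \<eta>)\<^sup>2)) \<partial>M) * indicator {0..\<epsilon>} \<eta> \<partial>lborel)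
    = (\<integral>\<^sup>+ t. ennreal (\<bar>t\<bar> ^ Suc j * arctan (\<bar>t\<bar> * \<epsilon>)) \<partial>M)"
proof -
  interpret pair_sigma_finite lborel M ..
  have "(\<integral>\<^sup>+ \<eta>. (\<integral>\<^sup>+ t. ennreal (\<bar>t\<bar> ^ (j + 2) / (1 + (t * \<eta>)\<^sup>2)) \<partial>M) * indicator {0..\<epsilon>} \<eta> \<partial>lborel)
    = (\<integral>\<^sup>+ \<eta>. (\<integral>\<^sup>+ t. ennreal (\<bar>t\<bar> ^ (j + 2) / (1 + (t * \<eta>)\<^sup>2)) * indicator {0..\<epsilon>} \<eta> \<partial>M) \<partial>lborel)"
    by (intro nn_integral_cong nn_integral_multc[symmetric]) simp
  also have "\<dots> = (\<integral>\<^sup>+ t. (\<integral>\<^sup>+ \<eta>. ennreal (\<bar>t\<bar> ^ (j + 2) / (1 + (t * \<eta>)\<^sup>2)) * indicator {0..\<epsilon>} \<eta> \<partial>lborel) \<partial>M)"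
    by (rule Fubini'[symmetric]) simp
  also have "\<dots> = (\<integral>\<^sup>+ t. ennreal (\<bar>t\<bar> ^ Suc j * arctan (\<bar>t\<bar> * \<epsilon>)) \<partial>M)"
  proof (intro nn_integral_cong)
    fix t
    have "(\<integral>\<^sup>+ \<eta>. ennreal (\<bar>t\<bar> ^ (j + 2) / (1 + (t * \<eta>)\<^sup>2)) * indicator {0..\<epsilon>} \<eta> \<partial>lborel)
      = ennreal (\<bar>t\<bar> ^ Suc j * arctan (\<bar>t\<bar> * \<epsilon>) - \<bar>t\<bar> ^ Suc j * arctan (\<bar>t\<bar> * 0))"
    proof (rule nn_integral_FTC_Icc)
      fix x :: real
      show "((\<lambda>x. \<bar>t\<bar> ^ Suc j * arctan (\<bar>t\<bar> * x)) has_real_derivative \<bar>t\<bar> ^ (j + 2) / (1 + (t * x)\<^sup>2)) 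
         (at x)"
        by (auto intro!: derivative_eq_intros simp: power_mult_distrib field_simps)
    qed (use assms in auto)
    then show "(\<integral>\<^sup>+ \<eta>. ennreal (\<bar>t\<bar> ^ (j + 2) / (1 + (t * \<eta>)\<^sup>2)) * indicator {0..\<epsilon>} \<eta> \<partial>lborel)
      = ennreal (\<bar>t\<bar> ^ Suc j * arctan (\<bar>t\<bar> * \<epsilon>))" by simp
  qed
  finally show ?thesis .
qed

lemma Im_integrable_germ_resolvent_moment:
  assumes "even j" "admits_moment M (Suc j)" "cone_curve w"
  shows "Im_integrable_germ (\<lambda>\<eta>. resolvent_moment M (Suc j) (w \<eta>))"
proof (rule Im_integrable_germI)
  have mj: "admits_moment M j" using admits_moment_lower[OF assms(2)] by simp
  show "bounded_germ (\<lambda>\<eta>. resolvent_moment M (Suc j) (w \<eta>))"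
    by (rule bounded_germ_resolvent_moment) fact+
  \<comment> \<open>The majorant supplied by \<open>Im_le_pole_weight\<close>; its integral is
    bounded through \<open>arctan < pi/2 < 2\<close>.\<close>
  define h where "h \<eta> = 16 * (LINT t|M. \<bar>t\<bar> ^ (j + 2) / (1 + (t * \<eta>)\<^sup>2))" for \<eta>
  have [measurable]: "h \<in> borel_measurable lborel" unfolding h_def by measurable
  show "set_integrable lborel {0<..<1} h"
    unfolding set_integrable_def
  proof (rule integrableI_bounded)
    have "(\<integral>\<^sup>+ \<eta>. ennreal (norm (indicat_real {0<..<1} \<eta> *\<^sub>R h \<eta>)) \<partial>lborel)
      \<le> (\<integral>\<^sup>+ \<eta>. 16 * ((\<integral>\<^sup>+ t. ennreal (\<bar>t\<bar> ^ (j + 2) / (1 + (t * \<eta>)\<^sup>2)) \<partial>M) * indicator {0..1} \<eta>) \<partial>lborel)"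
    proof (intro nn_integral_mono)
      fix \<eta> :: real
      show "ennreal (norm (indicat_real {0<..<1} \<eta> *\<^sub>R h \<eta>))
        \<le> 16 * ((\<integral>\<^sup>+ t. ennreal (\<bar>t\<bar> ^ (j + 2) / (1 + (t * \<eta>)\<^sup>2)) \<partial>M) * indicator {0..1} \<eta>)"
      proof (cases "\<eta> \<in> {0<..<1}")
        case True
        then have "(\<integral>\<^sup>+ t. ennreal (\<bar>t\<bar> ^ (j + 2) / (1 + (t * \<eta>)\<^sup>2)) \<partial>M)
            = ennreal (LINT t|M. \<bar>t\<bar> ^ (j + 2) / (1 + (t * \<eta>)\<^sup>2))"
          by (intro nn_integral_eq_integral integrable_pole_weight mj) auto
        moreover have "0 \<le> (LINT t|M. \<bar>t\<bar> ^ (j + 2) / (1 + (t * \<eta>)\<^sup>2))"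
          by (intro integral_nonneg_AE AE_I2) auto
        ultimately show ?thesis using True by (simp add: h_def ennreal_mult)
      qed simp
    qed
    also have "\<dots> = 16 * (\<integral>\<^sup>+ t. ennreal (\<bar>t\<bar> ^ Suc j * arctan (\<bar>t\<bar> * 1)) \<partial>M)"
      by (subst nn_integral_cmult, measurable) (subst nn_integral_pole_weight; simp)
    also have "\<dots> \<le> 16 * (\<integral>\<^sup>+ t. ennreal (2 * \<bar>t\<bar> ^ Suc j) \<partial>M)"
    proof (intro mult_left_mono nn_integral_mono ennreal_leI)
      fix t :: real
      have "\<bar>t\<bar> ^ Suc j * arctan (\<bar>t\<bar> * 1) \<le> \<bar>t\<bar> ^ Suc j * 2"
        using arctan_ubound[of "\<bar>t\<bar>"] pi_half_less_two by (intro mult_left_mono) auto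
      then show "\<bar>t\<bar> ^ Suc j * arctan (\<bar>t\<bar> * 1) \<le> 2 * \<bar>t\<bar> ^ Suc j" by simp
    qed simp
    also have "(\<integral>\<^sup>+ t. ennreal (2 * \<bar>t\<bar> ^ Suc j) \<partial>M) = ennreal (LINT t|M. 2 * \<bar>t\<bar> ^ Suc j)"
      using assms(2) by (intro nn_integral_eq_integral) (auto simp: admits_moment_def)
    also have "16 * \<dots> < \<infinity>" by (simp add: ennreal_mult_less_top)
    finally show "(\<integral>\<^sup>+ \<eta>. ennreal (norm (indicat_real {0<..<1} \<eta> *\<^sub>R h \<eta>)) \<partial>lborel) < \<infinity>" .
  qed measurable
  show "\<forall>\<^sub>F \<eta> in at_right 0. \<bar>Im (resolvent_moment M (Suc j) (w \<eta>))\<bar> \<le> \<eta> * h \<eta>"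
    using assms(3)[unfolded cone_curve_def] eventually_at_right_less[of "0::real"]
  proof eventually_elim
    case (elim \<eta>)
    then show ?case unfolding h_def using Im_le_pole_weight[OF assms(1) mj] by blast
  qed
qed simp

lemma admits_moment_if_Im_integrable_germ:
  assumes "even j" "admits_moment M j" "cone_curve w"
    and "Im_integrable_germ (\<lambda>\<eta>. resolvent_moment M (Suc j) (w \<eta>))"
  shows "admits_moment M (Suc j)"
proof -
  obtain h \<epsilon> where h: "\<epsilon> > 0" "set_integrable lborel {0<..<\<epsilon>} h"
    "\<forall>\<^sub>F \<eta> in at_right 0. \<bar>Im (resolvent_moment M (Suc j) (w \<eta>))\<bar> \<le> \<eta> * h \<eta>"
    using assms(4) by (auto simp: Im_integrable_germ_def)
  \<comment> \<open>Near 0 the majorant is nonnegative, since \<open>\<eta> h\<close> dominates an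
    absolute value; this lets it pass to \<open>ennreal\<close>.\<close>
  have "\<forall>\<^sub>F \<eta> in at_right 0. 0 \<le> h \<eta> \<and> (LINT t|M. \<bar>t\<bar> ^ (j + 2) / (1 + (t * \<eta>)\<^sup>2)) \<le> 4 * h \<eta>"
    using assms(3)[unfolded cone_curve_def] h(3) eventually_at_right_less[of "0::real"]
  proof eventually_elim
    case (elim \<eta>)
    have "0 \<le> \<eta> * h \<eta>" using elim by linarith
    moreover have "\<eta> * (LINT t|M. \<bar>t\<bar> ^ (j + 2) / (1 + (t * \<eta>)\<^sup>2)) \<le> \<eta> * (4 * h \<eta>)"
      using pole_weight_Im_le[OF assms(1,2), of \<eta> "w \<eta>"] elim by linarith
    ultimately show ?case using elim by (simp add: zero_le_mult_iff)
  qed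
  then obtain b where b: "b > 0" "\<And>\<eta>. 0 < \<eta> \<Longrightarrow> \<eta> < b \<Longrightarrow> 
      0 \<le> h \<eta> \<and> (LINT t|M. \<bar>t\<bar> ^ (j + 2) / (1 + (t * \<eta>)\<^sup>2)) \<le> 4 * h \<eta>"
    unfolding eventually_at_right_field by blast
  \<comment> \<open>Strictly below both bounds, so that on \<open>(0, e]\<close> the pointwise
    estimate and the integrability of \<open>h\<close> are both available.\<close>
  define e where "e = min \<epsilon> b / 2"
  have e: "e > 0" "e < \<epsilon>" "e < b" using h(1) b(1) by (auto simp: e_def)
  have "(\<integral>\<^sup>+ t. ennreal (\<bar>t\<bar> ^ Suc j * arctan (\<bar>t\<bar> * e)) \<partial>M)
    = (\<integral>\<^sup>+ \<eta>. (\<integral>\<^sup>+ t. ennreal (\<bar>t\<bar> ^ (j + 2) / (1 + (t * \<eta>)\<^sup>2)) \<partial>M) * indicator {0..e} \<eta> \<partial>lborel)"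
    by (rule nn_integral_pole_weight[OF e(1), symmetric])
  also have "\<dots> \<le> (\<integral>\<^sup>+ \<eta>. 4 * ennreal (norm (indicat_real {0<..<\<epsilon>} \<eta> *\<^sub>R h \<eta>)) \<partial>lborel)"
  proof (rule nn_integral_mono_AE)
    show "AE \<eta> in lborel. (\<integral>\<^sup>+ t. ennreal (\<bar>t\<bar> ^ (j + 2) / (1 + (t * \<eta>)\<^sup>2)) \<partial>M) * indicator {0..e} \<eta>
       \<le> 4 * ennreal (norm (indicat_real {0<..<\<epsilon>} \<eta> *\<^sub>R h \<eta>))"
      using AE_lborel_singleton[of "0::real"]
    proof eventually_elim
      case (elim \<eta>)
      show ?case
      proof (cases "\<eta> \<in> {0..e}")
        case True
        then have \<eta>: "0 < \<eta>" "\<eta> < b" "\<eta> < \<epsilon>" using elim e by auto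
        have "(\<integral>\<^sup>+ t. ennreal (\<bar>t\<bar> ^ (j + 2) / (1 + (t * \<eta>)\<^sup>2)) \<partial>M)
            = ennreal (LINT t|M. \<bar>t\<bar> ^ (j + 2) / (1 + (t * \<eta>)\<^sup>2))"
          using \<eta> by (intro nn_integral_eq_integral integrable_pole_weight assms) auto
        also have "\<dots> \<le> ennreal (4 * h \<eta>)" using b(2)[OF \<eta>(1,2)] by (intro ennreal_leI) simp
        also have "\<dots> = 4 * ennreal (h \<eta>)" using b(2)[OF \<eta>(1,2)] by (simp add: ennreal_mult)
        finally show ?thesis using True \<eta> b(2)[OF \<eta>(1,2)] by simp
      qed simp
    qed
  qed
  also have "\<dots> = 4 * (\<integral>\<^sup>+ \<eta>. ennreal (norm (indicat_real {0<..<\<epsilon>} \<eta> *\<^sub>R h \<eta>)) \<partial>lborel)"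
    using h(2) unfolding set_integrable_def by (intro nn_integral_cmult) auto
  also have "\<dots> < \<infinity>"
    using h(2) unfolding set_integrable_def integrable_iff_bounded by (simp add: ennreal_mult_less_top)
  finally have fin: "(\<integral>\<^sup>+ t. ennreal (\<bar>t\<bar> ^ Suc j * arctan (\<bar>t\<bar> * e)) \<partial>M) < \<infinity>" .
  have "integrable M (\<lambda>t. \<bar>t\<bar> ^ Suc j * arctan (\<bar>t\<bar> * e))"
  proof (rule integrableI_bounded)
    show "(\<integral>\<^sup>+ t. ennreal (norm (\<bar>t\<bar> ^ Suc j * arctan (\<bar>t\<bar> * e))) \<partial>M) < \<infinity>"
      using fin e(1) by (simp add: abs_mult)
  qed simp
  \<comment> \<open>The summand 1 dominates for \<open>|t| \<le> 1\<close>; for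
    \<open>|t| > 1\<close> monotonicity makes \<open>arctan (|t| e) / arctan e\<close> at least
    1.\<close>
  then have int: "integrable M (\<lambda>t. 1 + \<bar>t\<bar> ^ Suc j * arctan (\<bar>t\<bar> * e) / arctan e)" by simp
  show ?thesis unfolding admits_moment_def
  proof (rule Bochner_Integration.integrable_bound[OF int])
    have "\<bar>t\<bar> ^ Suc j \<le> 1 + \<bar>t\<bar> ^ Suc j * arctan (\<bar>t\<bar> * e) / arctan e" for t
    proof (cases "\<bar>t\<bar> \<le> 1")
      case True
      then have "\<bar>t\<bar> ^ Suc j \<le> 1" by (intro power_le_one) auto
      moreover have "0 \<le> \<bar>t\<bar> ^ Suc j * arctan (\<bar>t\<bar> * e) / arctan e" using e(1) by simp
      ultimately show ?thesis by linarith
    next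
      case False
      then have "arctan e \<le> arctan (\<bar>t\<bar> * e)" using e(1) by (simp add: arctan_le_iff)
      then have "\<bar>t\<bar> ^ Suc j * arctan e \<le> \<bar>t\<bar> ^ Suc j * arctan (\<bar>t\<bar> * e)" by (intro mult_left_mono) auto
      then have "\<bar>t\<bar> ^ Suc j \<le> \<bar>t\<bar> ^ Suc j * arctan (\<bar>t\<bar> * e) / arctan e" 
        using e(1) by (simp add: pos_le_divide_eq)
      then show ?thesis by linarith
    qed
    then have "norm (\<bar>t\<bar> ^ Suc j) \<le> norm (1 + \<bar>t\<bar> ^ Suc j * arctan (\<bar>t\<bar> * e) / arctan e)" for t
      unfolding real_norm_def abs_of_nonneg[OF zero_le_power_abs]
      by (meson abs_ge_self order_trans)
    then show "AE t in M. norm (\<bar>t\<bar> ^ Suc j) \<le> norm (1 + \<bar>t\<bar> ^ Suc j * arctan (\<bar>t\<bar> * e) / arctan e)"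
      by (intro AE_I2)
  qed simp
qed

text \<open>On the half-line \<open>s t \<ge> 0\<close> the kernel \<open>1 / (1 - t w)\<close> has no sign, but its real part minus
  \<open>s\<close> times its imaginary part dominates \<open>1 / \<bar>1 - t w\<bar>\<^sup>2\<close> as \<open>w\<close> is in the cone.\<close>

lemma admits_odd_moment_if_bounded_germ:
  assumes "odd p" "admits_moment M (p - 1)" "cone_curve w" "s\<^sup>2 = 1" and b: "AE t in M. - b \<le> s * t"
    and "bounded_germ (\<lambda>\<eta>. resolvent_moment M p (w \<eta>))"
  shows "admits_moment M p"
proof -
  have p: "Suc (p - 1) = p" using assms(1) by (simp add: odd_pos)
  have s: "s = 1 \<or> s = - 1" using assms(4) by (simp add: power2_eq_1_iff)
  obtain C where C: "\<forall>\<^sub>F \<eta> in at_right 0. cmod (resolvent_moment M p (w \<eta>)) \<le> C"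
    using assms(6) by (auto simp: bounded_germ_def)
  \<comment> \<open>Where \<open>- b \<le> s t < 0\<close>, one has \<open>|t| \<le> |b|\<close>:
    the weighted power is at most \<open>4 |b|^p\<close>, the real and imaginary parts of the kernel
    at most \<open>2 |b|^p\<close> each.\<close>
  define c where "c = 8 * \<bar>b\<bar> ^ p"
  have "\<forall>\<^sub>F \<eta> in at_right 0. integrable M (\<lambda>t. \<bar>t\<bar> ^ p / (1 + (t * \<eta>)\<^sup>2)) \<and>
      (LINT t|M. \<bar>t\<bar> ^ p / (1 + (t * \<eta>)\<^sup>2)) \<le> 2 * (2 * C + c * measure M (space M))"
    using assms(3)[unfolded cone_curve_def] C eventually_at_right_less[of "0::real"]
  proof eventually_elim
    case (elim \<eta>)
    let ?w = "w \<eta>"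
    have cone: "\<bar>Re ?w\<bar> \<le> - Im ?w" "cmod ?w \<le> \<eta>" "?w \<noteq> 0" using elim by auto
    define k where "k t = of_real (t ^ p) / (1 - of_real t * ?w)" for t
    have k: "integrable M k" 
      using integrable_resolvent_kernel_Suc[OF assms(2) cone(1,3)] unfolding k_def p .
    have Dk: "resolvent_moment M p ?w = (LINT t|M. k t)" by (simp add: resolvent_moment_def k_def)
    have int: "integrable M (\<lambda>t. 2 * (s * Re (k t) - Im (k t) + c))" using k by simp
    have key: "\<bar>t\<bar> ^ p / (cmod (1 - of_real t * ?w))\<^sup>2 \<le> s * Re (k t) - Im (k t) + c" if t: "- b \<le> s * t" for t
    proof -
      let ?N = "(cmod (1 - of_real t * ?w))\<^sup>2"
      have N0: "0 < ?N" using resolvent_nonzero[OF cone(1), of t] by simp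
      have k_eq: "k t = of_real (t ^ p) * (1 / (1 - of_real t * ?w))" by (simp add: k_def)
      have Re: "Re (k t) = t ^ p * ((1 - t * Re ?w) / ?N)" unfolding k_eq Re_of_real_mult Re_resolvent ..
      have Im: "Im (k t) = t ^ p * (t * Im ?w / ?N)" unfolding k_eq Im_of_real_mult Im_resolvent ..
      show ?thesis
      proof (cases "0 \<le> s * t")
        case True
        have st: "s * t = \<bar>t\<bar>" using True s by auto
        have stp: "s * t ^ p = \<bar>t\<bar> ^ p"
          using s st assms(1) by (metis mult_1 mult_minus_left power_minus_odd)
        have tp: "t ^ p = s * \<bar>t\<bar> ^ p" using stp assms(4) by (metis mult.left_commute mult_1 power2_eq_square mult.commute)
        have "\<bar>t\<bar> * \<bar>Re ?w\<bar> \<le> \<bar>t\<bar> * (- Im ?w)" using cone(1) by (intro mult_left_mono) auto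
        then have "t * Re ?w \<le> - (\<bar>t\<bar> * Im ?w)" 
          using abs_ge_self[of "t * Re ?w"] by (simp add: abs_mult)
        \<comment> \<open>The numerator of \<open>s Re k - Im k\<close>, up to the factor
          \<open>|t|^p\<close>.\<close>
        then have "1 \<le> 1 - t * Re ?w - \<bar>t\<bar> * Im ?w" by simp
        then have "\<bar>t\<bar> ^ p * (1 / ?N) \<le> \<bar>t\<bar> ^ p * ((1 - t * Re ?w - \<bar>t\<bar> * Im ?w) / ?N)"
          using N0 by (intro mult_left_mono divide_right_mono) auto
        also have "\<dots> = \<bar>t\<bar> ^ p * ((1 - t * Re ?w) / ?N) - \<bar>t\<bar> ^ p * (\<bar>t\<bar> * Im ?w / ?N)"
          by (simp add: diff_divide_distrib right_diff_distrib)
        also have "\<dots> = s * Re (k t) - Im (k t)"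
        proof -
          have "\<bar>t\<bar> ^ p * \<bar>t\<bar> = t ^ p * t" 
            unfolding tp st[symmetric] by (simp add: mult_ac)
          then have "\<bar>t\<bar> ^ p * (\<bar>t\<bar> * Im ?w / ?N) = Im (k t)" unfolding Im 
            by (metis mult.assoc times_divide_eq_right)
          moreover have "\<bar>t\<bar> ^ p * ((1 - t * Re ?w) / ?N) = s * Re (k t)" unfolding Re stp[symmetric] by simp
          ultimately show ?thesis by simp
        qed
        finally have "\<bar>t\<bar> ^ p * (1 / ?N) \<le> s * Re (k t) - Im (k t)" .
        moreover have "0 \<le> c" unfolding c_def by simp
        ultimately show ?thesis by simp
      next
        case False
        then have "\<bar>t\<bar> \<le> \<bar>b\<bar>" using t s by auto
        then have tb: "\<bar>t\<bar> ^ p \<le> \<bar>b\<bar> ^ p" by (intro power_mono) auto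
        have "1\<^sup>2 \<le> (2 * cmod (1 - of_real t * ?w))\<^sup>2" 
          using norm_resolvent_bound(1)[OF cone(1), of t] by (intro power_mono) auto
        then have "1 / ?N \<le> 4" using N0 by (simp add: power_mult_distrib divide_le_eq)
        then have "\<bar>t\<bar> ^ p * (1 / ?N) \<le> \<bar>b\<bar> ^ p * 4" using tb N0 by (intro mult_mono) auto
        moreover have "cmod (k t) \<le> 2 * \<bar>b\<bar> ^ p" 
          using norm_resolvent_kernel[OF cone(1), of t p] tb unfolding k_def by linarith
        moreover have "\<bar>s * Re (k t)\<bar> \<le> cmod (k t)" using s abs_Re_le_cmod[of "k t"] by auto
        moreover have "\<bar>Im (k t)\<bar> \<le> cmod (k t)" by (rule abs_Im_le_cmod)
        ultimately show ?thesis unfolding c_def by simp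
      qed
    qed
    have key': "\<bar>t\<bar> ^ p / (1 + (t * \<eta>)\<^sup>2) \<le> 2 * (s * Re (k t) - Im (k t) + c)" if "- b \<le> s * t" for t
    proof -
      have "\<bar>t\<bar> ^ p * (1 / (1 + (t * \<eta>)\<^sup>2)) \<le> \<bar>t\<bar> ^ p * (2 / (cmod (1 - of_real t * ?w))\<^sup>2)"
        using elim cone by (intro mult_left_mono resolvent_weight_ge) auto
      then show ?thesis using mult_left_mono[OF key[OF that], of 2] by (simp add: mult_ac)
    qed
    have AE: "AE t in M. \<bar>t\<bar> ^ p / (1 + (t * \<eta>)\<^sup>2) \<le> 2 * (s * Re (k t) - Im (k t) + c)"
      using b by eventually_elim (rule key')
    \<comment> \<open>The order may be 1, below the range of \<open>integrable_pole_weight\<close>,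
      so integrability comes from domination by the kernel.\<close>
    have int': "integrable M (\<lambda>t. \<bar>t\<bar> ^ p / (1 + (t * \<eta>)\<^sup>2))"
    proof (rule Bochner_Integration.integrable_bound[OF int])
      show "AE t in M. norm (\<bar>t\<bar> ^ p / (1 + (t * \<eta>)\<^sup>2)) \<le> norm (2 * (s * Re (k t) - Im (k t) + c))"
        using AE
      proof eventually_elim
        case (elim t)
        have "0 \<le> \<bar>t\<bar> ^ p / (1 + (t * \<eta>)\<^sup>2)" by simp
        with elim show ?case unfolding real_norm_def by linarith
      qed
    qed simp
    have "(LINT t|M. \<bar>t\<bar> ^ p / (1 + (t * \<eta>)\<^sup>2)) \<le> (LINT t|M. 2 * (s * Re (k t) - Im (k t) + c))"
      by (rule integral_mono_AE[OF int' int AE])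
    also have "\<dots> = 2 * (s * Re (LINT t|M. k t) - Im (LINT t|M. k t) + c * measure M (space M))"
      using k by (simp add: integral_Re integral_Im)
    also have "\<dots> \<le> 2 * (2 * C + c * measure M (space M))"
      using s elim abs_Re_le_cmod[of "LINT t|M. k t"] abs_Im_le_cmod[of "LINT t|M. k t"] unfolding Dk by auto
    finally have "(LINT t|M. \<bar>t\<bar> ^ p / (1 + (t * \<eta>)\<^sup>2)) \<le> 2 * (2 * C + c * measure M (space M))" .
    with int' show ?case by simp
  qed
  then show ?thesis unfolding admits_moment_def
    by (intro integrable_if_pole_weighted_bounded[where g="\<lambda>t. t"]) auto
qed

end

subsection \<open>The functional equation on the imaginary axis\<close>

text \<open>The complement of the support is a union of open null sets, and by Lindelof countably
  many of them already cover it.\<close>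

lemma AE_measure_support:
  fixes M :: "'a::second_countable_topology measure"
  assumes "sets M = sets borel"
  shows "AE x in M. x \<in> measure_support M"
proof -
  define \<F> where "\<F> = {U. open U \<and> emeasure M U = 0}"
  obtain \<F>' where F: "\<F>' \<subseteq> \<F>" "countable \<F>'" "\<Union>\<F>' = \<Union>\<F>"
    using Lindelof[of \<F>] by (auto simp: \<F>_def)
  have "\<Union>\<F>' \<in> null_sets M"
  proof (rule null_sets_UN'[of \<F>' id, simplified])
    fix U assume "U \<in> \<F>'"
    then have "open U" "emeasure M U = 0" using F by (auto simp: \<F>_def)
    then show "U \<in> null_sets M" using assms by (auto simp: null_sets_def)
  qed fact
  then show ?thesis
  proof (rule AE_I')
    show "{x \<in> space M. x \<notin> measure_support M} \<subseteq> \<Union>\<F>'"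
      unfolding F(3) by (auto simp: measure_support_def \<F>_def)
  qed
qed

definition imag_curve :: "real \<Rightarrow> complex" where
  "imag_curve \<eta> = Complex 0 (- \<eta>)"

lemma cone_curve_imag_curve: "cone_curve imag_curve"
  unfolding cone_curve_def using eventually_at_right_less[of "0::real"]
  by eventually_elim (simp add: imag_curve_def cmod_def)

text \<open>For the product \<open>w\<close>, \<open>Re w = \<eta> Im u\<close> and
  \<open>Im w = - \<eta> Re u\<close>. So \<open>|u - 1| < 1/2\<close> gives the cone and the lower
  bound, \<open>|u| \<le> 1\<close> the upper bound on the modulus.\<close>

lemma cone_curve_imag_curve_mult:
  assumes "\<forall>\<^sub>F \<eta> in at_right 0. cmod (u \<eta>) \<le> 1" "(u \<longlongrightarrow> 1) (at_right 0)"
  shows "cone_curve (\<lambda>\<eta>. imag_curve \<eta> * u \<eta>)"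
proof -
  have "\<forall>\<^sub>F \<eta> in at_right 0. dist (u \<eta>) 1 < 1 / 2" using assms(2) by (rule tendstoD) simp
  then show ?thesis unfolding cone_curve_def using assms(1) eventually_at_right_less[of "0::real"]
  proof eventually_elim
    case (elim \<eta>)
    have "\<bar>Re (u \<eta>) - 1\<bar> < 1 / 2" "\<bar>Im (u \<eta>)\<bar> < 1 / 2"
      using elim(1) abs_Re_le_cmod[of "u \<eta> - 1"] abs_Im_le_cmod[of "u \<eta> - 1"] by (auto simp: dist_norm)
    then have u: "1 / 2 \<le> Re (u \<eta>)" "\<bar>Im (u \<eta>)\<bar> \<le> Re (u \<eta>)" by linarith+
    have "\<eta> * (1 / 2) \<le> \<eta> * Re (u \<eta>)" "\<eta> * \<bar>Im (u \<eta>)\<bar> \<le> \<eta> * Re (u \<eta>)"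
      using u elim(3) by (auto intro!: mult_left_mono)
    moreover have "cmod (imag_curve \<eta> * u \<eta>) \<le> \<eta> * 1"
      unfolding norm_mult using elim by (intro mult_mono) (auto simp: imag_curve_def cmod_def)
    ultimately show ?case using elim(3) by (simp add: imag_curve_def abs_mult)
  qed
qed

lemma cauchy_inv_eq:
  assumes "z \<noteq> 0"
  shows "cauchy_inv \<mu> z = z * resolvent_moment \<mu> 0 z"
proof -
  \<comment> \<open>Where \<open>t z = 1\<close> both integrands are 0 by the convention on division
    by 0, so they agree at every \<open>t\<close>.\<close>
  have "cauchy_inv \<mu> z = (LINT t|\<mu>. z * (of_real (t ^ 0) / (1 - of_real t * z)))"
    unfolding cauchy_inv_def cauchy_transform_def
    by (intro Bochner_Integration.integral_cong refl) (use assms in \<open>simp add: divide_simps\<close>)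
  then show ?thesis unfolding resolvent_moment_def by (simp only: integral_mult_right_zero)
qed

text \<open>Integrates
  \<open>w (w + t) / (1 - t w) = (1 + w\<^sup>2) / (1 - t w) - 1\<close>.\<close>

lemma (in finite_borel_measure) levy_integral_eq:
  assumes w: "\<bar>Re w\<bar> \<le> - Im w"
  shows "w * (LINT t|M. (w + of_real t) / (1 - of_real t * w))
    = (1 + w\<^sup>2) * resolvent_moment M 0 w - of_real (measure M (space M))"
proof -
  have int: "integrable M (\<lambda>t. of_real (t ^ 0) / (1 - of_real t * w))"
    using w by (intro integrable_resolvent_kernel) (simp_all add: admits_moment_def)
  have "w * (LINT t|M. (w + of_real t) / (1 - of_real t * w))
    = (LINT t|M. w * ((w + of_real t) / (1 - of_real t * w)))" by (rule integral_mult_right_zero[symmetric])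
  also have "\<dots> = (LINT t|M. (1 + w\<^sup>2) * (of_real (t ^ 0) / (1 - of_real t * w)) - 1)"
  proof (intro Bochner_Integration.integral_cong refl)
    fix t
    show "w * ((w + of_real t) / (1 - of_real t * w))
        = (1 + w\<^sup>2) * (of_real (t ^ 0) / (1 - of_real t * w)) - 1"
      using resolvent_nonzero[OF w, of t] by (simp add: divide_simps) (simp add: power2_eq_square algebra_simps)
  qed
  also have "\<dots> = (1 + w\<^sup>2) * resolvent_moment M 0 w - (LINT t|M. 1)"
    unfolding resolvent_moment_def integral_mult_right_zero[symmetric] using int
    by (intro Bochner_Integration.integral_diff integrable_mult_right) auto
  finally show ?thesis by (simp add: scaleR_conv_of_real)
qed

text \<open>With \<open>z = - \<i> \<eta>\<close>, the function \<open>u\<close> is \<open>G(1/z)/z\<close> and \<open>w = z u\<close> is \<open>G(1/z)\<close>;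
  the last conclusion is \<open>1/z = 1/w + R(w)\<close> multiplied by \<open>w\<close>.\<close>

lemma free_id_law_functional_equation:
  assumes \<sigma>: "finite_borel_measure \<sigma>" and law: "is_free_id_law \<gamma> \<sigma> \<nu>"
  defines "u \<equiv> \<lambda>\<eta>. resolvent_moment \<nu> 0 (imag_curve \<eta>)"
  defines "w \<equiv> \<lambda>\<eta>. imag_curve \<eta> * u \<eta>"
  shows "(u \<longlongrightarrow> 1) (at_right 0)" "cone_curve w"
    "\<forall>\<^sub>F \<eta> in at_right 0. u \<eta> = of_real (1 - measure \<sigma> (space \<sigma>)) + of_real \<gamma> * w \<eta>
        + (1 + (w \<eta>)\<^sup>2) * resolvent_moment \<sigma> 0 (w \<eta>)"
proof -
  interpret \<sigma>: finite_borel_measure \<sigma> by fact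
  interpret \<nu>: real_distribution \<nu> using law by (simp add: is_free_id_law_def)
  show lim: "(u \<longlongrightarrow> 1) (at_right 0)"
    using \<nu>.tendsto_resolvent_moment[OF _ cone_curve_imag_curve, of 0] \<nu>.prob_space
    unfolding u_def by (simp add: admits_moment_def)
  have "\<forall>\<^sub>F \<eta> in at_right 0. cmod (u \<eta>) \<le> 1"
    using eventually_at_right_less[of "0::real"]
  proof eventually_elim
    case (elim \<eta>)
    \<comment> \<open>On the imaginary axis \<open>1 - t z\<close> has real part 1. This gives the
      kernel bound 1 instead of the 2 of \<open>norm_resolvent_kernel\<close>, as the modulus
      condition of \<open>cone_curve\<close> demands.\<close>
    have 1: "1 \<le> cmod (1 - of_real t * imag_curve \<eta>)" for t
      using abs_Re_le_cmod[of "1 - of_real t * imag_curve \<eta>"] by (simp add: imag_curve_def)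
    have le: "cmod (of_real (t ^ 0) / (1 - of_real t * imag_curve \<eta>)) \<le> 1" for t
    proof -
      have "0 < cmod (1 - of_real t * imag_curve \<eta>)" using 1[of t] by linarith
      then show ?thesis using 1[of t] by (simp add: norm_divide)
    qed
    have "cmod (u \<eta>) \<le> (LINT t|\<nu>. 1)"
      unfolding u_def resolvent_moment_def
    proof (rule Bochner_Integration.integral_norm_bound_integral)
      show "integrable \<nu> (\<lambda>t. of_real (t ^ 0) / (1 - of_real t * imag_curve \<eta>))"
        using elim by (intro \<nu>.integrable_resolvent_kernel) (simp_all add: admits_moment_def imag_curve_def)
    qed (use le in auto)
    then show ?case using \<nu>.prob_space by simp
  qed
  then show cone: "cone_curve w" unfolding w_def using lim by (rule cone_curve_imag_curve_mult)
  define R where "R z = complex_of_real \<gamma> + (LINT t|\<sigma>. (z + complex_of_real t) / (1 - complex_of_real t * z))" for z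
  have "has_R_transform \<nu> R" using law unfolding is_free_id_law_def R_def by simp
  \<comment> \<open>The curve runs inside the cone of aperture 1 and lies in
    \<open>Delta 1 \<beta>\<close> once \<open>0 < \<eta> < \<beta>\<close>, so one such
    \<open>\<beta>\<close> is fixed.\<close>
  then have "\<forall>\<^sub>F \<beta> in at_right 0. inj_on (cauchy_inv \<nu>) (Delta 1 \<beta>) \<and>
        (\<forall>w \<in> cauchy_inv \<nu> ` Delta 1 \<beta>. R w = 1 / L_branch \<nu> 1 \<beta> w - 1 / w)"
    unfolding has_R_transform_def using zero_less_one by blast
  then have "\<forall>\<^sub>F \<beta> in at_right 0. 0 < \<beta> \<and> inj_on (cauchy_inv \<nu>) (Delta 1 \<beta>) \<and>
        (\<forall>w \<in> cauchy_inv \<nu> ` Delta 1 \<beta>. R w = 1 / L_branch \<nu> 1 \<beta> w - 1 / w)"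
    using eventually_at_right_less[of "0::real"] by eventually_elim blast
  then obtain \<beta> where \<beta>: "0 < \<beta>" "inj_on (cauchy_inv \<nu>) (Delta 1 \<beta>)"
      "\<And>w. w \<in> cauchy_inv \<nu> ` Delta 1 \<beta> \<Longrightarrow> R w = 1 / L_branch \<nu> 1 \<beta> w - 1 / w"
    by (metis (mono_tags, lifting) eventually_happens trivial_limit_at_right_real)
  have "\<forall>\<^sub>F \<eta> in at_right (0::real). \<eta> \<in> {0<..<\<beta>}" by (rule eventually_at_right_real) fact
  moreover have "\<forall>\<^sub>F \<eta> in at_right 0. u \<eta> \<noteq> 0"
    using lim by (rule tendsto_imp_eventually_ne) simp
  ultimately show "\<forall>\<^sub>F \<eta> in at_right 0. u \<eta> = of_real (1 - measure \<sigma> (space \<sigma>)) + of_real \<gamma> * w \<eta>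
        + (1 + (w \<eta>)\<^sup>2) * resolvent_moment \<sigma> 0 (w \<eta>)"
    using cone[unfolded cone_curve_def]
  proof eventually_elim
    case (elim \<eta>)
    let ?z = "imag_curve \<eta>"
    have z0: "?z \<noteq> 0" using elim(1) by (simp add: imag_curve_def complex_eq_iff)
    have z: "?z \<in> Delta 1 \<beta>" using elim(1) by (simp add: Delta_def imag_curve_def cmod_def)
    have w: "cauchy_inv \<nu> ?z = w \<eta>" using cauchy_inv_eq[OF z0] by (simp add: w_def u_def)
    \<comment> \<open>Injectivity on \<open>Delta 1 \<beta>\<close> makes the branch return the
      point \<open>z\<close> itself.\<close>
    have "L_branch \<nu> 1 \<beta> (w \<eta>) = ?z"
      unfolding L_branch_def w[symmetric] by (rule the_inv_into_f_f[OF \<beta>(2) z])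
    then have R: "R (w \<eta>) = 1 / ?z - 1 / w \<eta>" using \<beta>(3)[of "w \<eta>"] z w by force
    have "w \<eta> * R (w \<eta>) = u \<eta> - 1"
      unfolding R using z0 elim(2) by (simp add: w_def field_simps)
    moreover have "w \<eta> * R (w \<eta>) = of_real \<gamma> * w \<eta>
        + ((1 + (w \<eta>)\<^sup>2) * resolvent_moment \<sigma> 0 (w \<eta>) - of_real (measure \<sigma> (space \<sigma>)))"
      using \<sigma>.levy_integral_eq[of "w \<eta>"] elim(3) unfolding R_def by (simp add: distrib_left mult.commute)
    ultimately show ?case by (simp add: algebra_simps)
  qed
qed

text \<open>Bootstrap: \<open>w = z u\<close>, so \<open>m\<close> known terms of \<open>u\<close> in \<open>z\<close> turn \<open>m + 1\<close> terms in \<open>w\<close> into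
  \<open>m + 1\<close> terms in \<open>z\<close>.\<close>

lemma (in germ_algebra) expansion_transfer_to_law:
  assumes "small_germ z" "small_germ w"
    and w: "\<forall>\<^sub>F \<eta> in at_right 0. w \<eta> = z \<eta> * u \<eta>"
    and u: "\<forall>\<^sub>F \<eta> in at_right 0. u \<eta> = of_real a + of_real \<gamma> * w \<eta> + (1 + (w \<eta>)\<^sup>2) * f \<eta>"
    and f: "expansion B w n f"
  shows "expansion B z n u"
proof -
  have "expansion B w n (\<lambda>\<eta>. of_real a + of_real \<gamma> * w \<eta> + (of_real 1 + w \<eta> * w \<eta>) * f \<eta>)"
    using assms(2) f
    by (intro expansion_add expansion_mult expansion_const expansion_self)
  then have uw: "expansion B w n u"
    by (rule expansion_cong) (use u in \<open>simp add: power2_eq_square\<close>)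
  have "m \<le> n \<Longrightarrow> expansion B z m u" for m
  proof (induction m)
    case 0
    then show ?case using expansion_base[OF assms(2) uw] by simp
  next
    case (Suc m)
    then show ?case
      using expansion_change_of_variable[OF assms(1) w expansion_lower[OF assms(2) uw, of "Suc m"]] by simp
  qed
  then show ?thesis by simp
qed

text \<open>Reverse bootstrap along \<open>z = w / u\<close>: each further term of \<open>u\<close>
  in \<open>w\<close> uses the reciprocal of \<open>u\<close> to the order already reached,
  available because \<open>u\<close> tends to 1. The functional equation is then solved for
  \<open>f\<close> by dividing by \<open>1 + w\<^sup>2\<close>.\<close>

lemma expansion_transfer_to_levy:
  assumes "small_germ z" "small_germ w"
    and w: "\<forall>\<^sub>F \<eta> in at_right 0. w \<eta> = z \<eta> * u \<eta>" and lim: "(u \<longlongrightarrow> 1) (at_right 0)"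
    and u: "\<forall>\<^sub>F \<eta> in at_right 0. u \<eta> = of_real a + of_real \<gamma> * w \<eta> + (1 + (w \<eta>)\<^sup>2) * f \<eta>"
    and uz: "expansion bounded_germ z n u"
  shows "expansion bounded_germ w n f"
proof -
  have nz: "\<forall>\<^sub>F \<eta> in at_right 0. u \<eta> \<noteq> 0"
    using lim by (rule tendsto_imp_eventually_ne) simp
  then have z: "\<forall>\<^sub>F \<eta> in at_right 0. z \<eta> = w \<eta> * inverse (u \<eta>)"
    using w by eventually_elim simp
  have "m \<le> n \<Longrightarrow> expansion bounded_germ w m u" for m
  proof (induction m)
    case 0
    then show ?case using bounded.expansion_base[OF assms(1) uz] by simp
  next
    case (Suc m)
    have "expansion bounded_germ w m (\<lambda>\<eta>. inverse (u \<eta>))"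
      using Suc by (intro expansion_inverse[OF assms(2) _ lim]) auto
    then show ?case
      using bounded.expansion_change_of_variable[OF assms(2) z bounded.expansion_lower[OF assms(1) uz, of "Suc m"]] Suc
      by simp
  qed
  then have uw: "expansion bounded_germ w n u" by simp
  have "((\<lambda>\<eta>. of_real 1 + w \<eta> * w \<eta>) \<longlongrightarrow> of_real 1 + 0 * 0) (at_right 0)"
    by (intro tendsto_intros tendsto_small_germ assms)
  then have lim': "((\<lambda>\<eta>. of_real 1 + w \<eta> * w \<eta>) \<longlongrightarrow> 1) (at_right 0)" by simp
  have "expansion bounded_germ w n (\<lambda>\<eta>. of_real 1 + w \<eta> * w \<eta>)"
    by (intro bounded.expansion_add bounded.expansion_mult bounded.expansion_const bounded.expansion_self assms)
  then have inv: "expansion bounded_germ w n (\<lambda>\<eta>. inverse (of_real 1 + w \<eta> * w \<eta>))"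
    by (rule expansion_inverse[OF assms(2) _ lim']) simp
  have "expansion bounded_germ w n
      (\<lambda>\<eta>. (u \<eta> + (of_real (- a) + of_real (- \<gamma>) * w \<eta>)) * inverse (of_real 1 + w \<eta> * w \<eta>))"
    by (intro bounded.expansion_add bounded.expansion_mult bounded.expansion_const
        bounded.expansion_self assms(2) inv uw)
  then show ?thesis
  proof (rule bounded.expansion_cong)
    have "\<forall>\<^sub>F \<eta> in at_right 0. of_real 1 + w \<eta> * w \<eta> \<noteq> 0"
      using lim' by (rule tendsto_imp_eventually_ne) simp
    then show "\<forall>\<^sub>F \<eta> in at_right 0. f \<eta> =
        (u \<eta> + (of_real (- a) + of_real (- \<gamma>) * w \<eta>)) * inverse (of_real 1 + w \<eta> * w \<eta>)"
      using u by eventually_elim (simp add: field_simps power2_eq_square)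
  qed
qed

section \<open>Both implications, by parity of the order\<close>

theorem proposition2p3:
  fixes \<gamma> :: real and \<sigma> \<nu> :: "real measure" and p :: nat
  assumes "finite_borel_measure \<sigma>"
    and "p > 0"
    and "is_free_id_law \<gamma> \<sigma> \<nu>"
  shows "(admits_moment \<sigma> p \<longrightarrow> admits_moment \<nu> p) \<and>
    (even p \<or> bdd_below (measure_support \<sigma>) \<or> bdd_above (measure_support \<sigma>) \<longrightarrow>
       admits_moment \<nu> p \<longrightarrow> admits_moment \<sigma> p)"
proof -
  interpret \<sigma>: finite_borel_measure \<sigma> by fact
  interpret \<nu>: real_distribution \<nu> using assms by (simp add: is_free_id_law_def)
  define u where "u = (\<lambda>\<eta>. resolvent_moment \<nu> 0 (imag_curve \<eta>))"
  define w where "w = (\<lambda>\<eta>. imag_curve \<eta> * u \<eta>)"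
  define f where "f = (\<lambda>\<eta>. resolvent_moment \<sigma> 0 (w \<eta>))"
  define a where "a = 1 - measure \<sigma> (space \<sigma>)"
  have lim: "(u \<longlongrightarrow> 1) (at_right 0)" and cone: "cone_curve w"
    and eq: "\<forall>\<^sub>F \<eta> in at_right 0. u \<eta> = of_real a + of_real \<gamma> * w \<eta> + (1 + (w \<eta>)\<^sup>2) * f \<eta>"
    unfolding w_def u_def f_def a_def by (rule free_id_law_functional_equation[OF assms(1,3)])+
  have w: "\<forall>\<^sub>F \<eta> in at_right 0. w \<eta> = imag_curve \<eta> * u \<eta>" by (simp add: w_def)
  note small = cone_curve_small[OF cone_curve_imag_curve] cone_curve_small[OF cone]
  have to_law: "expansion B imag_curve p u"
    if "germ_algebra B" "admits_moment \<sigma> p" "B (\<lambda>\<eta>. resolvent_moment \<sigma> p (w \<eta>))" for B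
  proof (rule germ_algebra.expansion_transfer_to_law[OF that(1) small w eq])
    show "expansion B w p f"
      using \<sigma>.expansion_resolvent_moment[OF that(1) cone that(2,3), of p] by (simp add: f_def)
  qed
  have even_p: "expansion bounded_germ imag_curve (2 * k) u \<Longrightarrow> admits_moment \<nu> (2 * k)" for k
    using \<nu>.admits_even_moment_if_expansion[OF cone_curve_imag_curve, of k] by (simp add: u_def)
  have "admits_moment \<nu> p" if mom: "admits_moment \<sigma> p"
  proof (cases "even p")
    case True
    then show ?thesis
      using even_p[of "p div 2"] to_law[OF bounded.germ_algebra_axioms mom
          \<sigma>.bounded_germ_resolvent_moment[OF mom cone]] by simp
  next
    case False
    then obtain k where k: "p = Suc (2 * k)" by (auto elim: oddE)
    \<comment> \<open>First pass: bounded remainders yield the even order \<open>2 k\<close> just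
      below \<open>p\<close>.\<close>
    have "expansion bounded_germ imag_curve p u"
      by (rule to_law[OF bounded.germ_algebra_axioms mom \<sigma>.bounded_germ_resolvent_moment[OF mom cone]])
    then have 1: "admits_moment \<nu> (2 * k)"
      using even_p bounded.expansion_lower[OF small(1), of p u "2 * k"] by (simp add: k)
    \<comment> \<open>Second pass with the finer class: the moment of order \<open>2 k\<close>
      allows all \<open>p\<close> terms to be dropped, and what remains is the resolvent moment of
      order \<open>p\<close>.\<close>
    have "expansion Im_integrable_germ imag_curve p u"
      using \<sigma>.Im_integrable_germ_resolvent_moment[of "2 * k"] mom cone
      by (intro to_law[OF Im_integrable.germ_algebra_axioms mom]) (simp add: k)
    then have "Im_integrable_germ (\<lambda>\<eta>. resolvent_moment \<nu> (Suc (2 * k)) (imag_curve \<eta>))"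
      using \<nu>.expansion_resolvent_moment_drop[OF Im_integrable.germ_algebra_axioms cone_curve_imag_curve 1, of 0]
      by (simp add: k u_def)
    then show ?thesis
      using \<nu>.admits_moment_if_Im_integrable_germ[OF _ 1 cone_curve_imag_curve] by (simp add: k)
  qed
  moreover have "admits_moment \<sigma> p"
    if supp: "even p \<or> bdd_below (measure_support \<sigma>) \<or> bdd_above (measure_support \<sigma>)"
      and mom: "admits_moment \<nu> p"
  proof -
    have "expansion bounded_germ imag_curve p u"
      using \<nu>.expansion_resolvent_moment[OF bounded.germ_algebra_axioms cone_curve_imag_curve mom
          \<nu>.bounded_germ_resolvent_moment[OF mom cone_curve_imag_curve], of p]
      by (simp add: u_def)
    then have ex: "expansion bounded_germ w p f"
      by (rule expansion_transfer_to_levy[OF small w lim eq])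
    show ?thesis
    proof (cases "even p")
      case True
      then show ?thesis
        using \<sigma>.admits_even_moment_if_expansion[OF cone, of "p div 2"] ex by (simp add: f_def)
    next
      case False
      then obtain k where k: "p = Suc (2 * k)" by (auto elim: oddE)
      have 1: "admits_moment \<sigma> (2 * k)"
        using bounded.expansion_lower[OF small(2) ex, of "2 * k"]
        by (intro \<sigma>.admits_even_moment_if_expansion[OF cone]) (simp add: k f_def)
      have bd: "bounded_germ (\<lambda>\<eta>. resolvent_moment \<sigma> p (w \<eta>))"
        using \<sigma>.expansion_resolvent_moment_drop[OF bounded.germ_algebra_axioms cone 1, of 0] ex
        by (simp add: k f_def)
      \<comment> \<open>\<open>s\<close> orients the half-line: 1 for a support bounded below, -1
        for one bounded above.\<close>
      have "\<exists>s b. s\<^sup>2 = (1::real) \<and> (\<forall>t \<in> measure_support \<sigma>. - b \<le> s * t)"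
        using supp False
      proof (elim disjE)
        assume "bdd_below (measure_support \<sigma>)"
        then obtain c where "\<forall>t \<in> measure_support \<sigma>. c \<le> t" by (auto simp: bdd_below_def)
        then show ?thesis by (intro exI[of _ 1] exI[of _ "- c"]) simp
      next
        assume "bdd_above (measure_support \<sigma>)"
        then obtain c where "\<forall>t \<in> measure_support \<sigma>. t \<le> c" by (auto simp: bdd_above_def)
        then show ?thesis by (intro exI[of _ "- 1"] exI[of _ c]) simp
      qed simp
      then obtain s b where s: "s\<^sup>2 = (1::real)" and b: "\<forall>t \<in> measure_support \<sigma>. - b \<le> s * t" by blast
      have "AE t in \<sigma>. - b \<le> s * t"
        using AE_measure_support[OF \<sigma>.M_is_borel] by eventually_elim (use b in blast)
      then show ?thesis
        using \<sigma>.admits_odd_moment_if_bounded_germ[OF False _ cone s _ bd] 1 by (simp add: k)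
    qed
  qed
  ultimately show ?thesis by blast
qed

end
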